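(* Let $n \ge 1$ be an integer. For $u \in W^{1,1}(\mathbf{R}^{n+1}_+)$, $u \ne 0$, let $$J(u) = \frac{\int_{\mathbf{R}^{n+1}_+} |\nabla u(x,y)|\,dx\,dy}{\int_{\mathbf{R}^n} |u(x,0)|\,dx}.$$ Then $$\inf\{ J(u) : u \in W^{1,1}(\mathbf{R}^{n+1}_+),\ u \neq 0 \} = 1.$$
   Context: $\mathbf{R}^{n+1}_+ = \{(x,y) : x \in \mathbf{R}^n,\ y > 0\}$; $W^{1,1}(\mathbf{R}^{n+1}_+)$ is the Sobolev space of functions in $L^1(\mathbf{R}^{n+1}_+)$ with weak gradient in $L^1(\mathbf{R}^{n+1}_+)$; $u(x,0)$ denotes the trace of $u$ on $\mathbf{R}^n$. If $u\neq 0$ has zero trace, $J(u)$ is understood as $+\infty$. *)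

theory Defs
  imports "HOL-Analysis.Analysis"
begin

text \<open>Functions on an open set \<open>\<Omega>\<close> are total functions of which only the values on \<open>\<Omega>\<close> matter.
  \<open>L\<^sup>1(\<Omega>)\<close> is \<^const>\<open>set_integrable\<close> with respect to Lebesgue measure, written
  \<open>absolutely_integrable_on\<close>.  The partial derivative \<open>\<partial>\<^sub>i \<phi>(z)\<close>, for \<open>i \<in> Basis\<close>, is
  \<open>frechet_derivative \<phi> (at z) i\<close>.\<close>

primrec Ck :: "nat \<Rightarrow> ('a::euclidean_space \<Rightarrow> real) \<Rightarrow> bool" where
  "Ck 0 \<phi> \<longleftrightarrow> continuous_on UNIV \<phi>"
| "Ck (Suc k) \<phi> \<longleftrightarrow> (\<forall>z. \<phi> differentiable (at z)) \<and>
     (\<forall>i\<in>Basis. Ck k (\<lambda>z. frechet_derivative \<phi> (at z) i))"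

definition smooth :: "('a::euclidean_space \<Rightarrow> real) \<Rightarrow> bool" where
  "smooth \<phi> \<longleftrightarrow> (\<forall>k. Ck k \<phi>)"

definition test_fun :: "'a::euclidean_space set \<Rightarrow> ('a \<Rightarrow> real) \<Rightarrow> bool" where
  "test_fun \<Omega> \<phi> \<longleftrightarrow> smooth \<phi> \<and> (\<exists>K. compact K \<and> K \<subseteq> \<Omega> \<and> (\<forall>z. z \<notin> K \<longrightarrow> \<phi> z = 0))"

definition has_weak_grad ::
    "'a::euclidean_space set \<Rightarrow> ('a \<Rightarrow> real) \<Rightarrow> ('a \<Rightarrow> 'a) \<Rightarrow> bool" where
  "has_weak_grad \<Omega> u g \<longleftrightarrow>
     u absolutely_integrable_on \<Omega> \<and> g absolutely_integrable_on \<Omega> \<and>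
     (\<forall>\<phi>. test_fun \<Omega> \<phi> \<longrightarrow> (\<forall>i\<in>Basis.
        (LINT z:\<Omega>|lebesgue. u z * frechet_derivative \<phi> (at z) i) =
        - (LINT z:\<Omega>|lebesgue. (g z \<bullet> i) * \<phi> z)))"

definition W11 :: "'a::euclidean_space set \<Rightarrow> ('a \<Rightarrow> real) set" where
  "W11 \<Omega> = {u. \<exists>g. has_weak_grad \<Omega> u g}"

text \<open>The weak gradient is determined only up to null sets; \<open>weak_grad\<close> picks a representative.\<close>

definition weak_grad :: "'a::euclidean_space set \<Rightarrow> ('a \<Rightarrow> real) \<Rightarrow> 'a \<Rightarrow> 'a" where
  "weak_grad \<Omega> u = (SOME g. has_weak_grad \<Omega> u g)"

definition W11_norm :: "'a::euclidean_space set \<Rightarrow> ('a \<Rightarrow> real) \<Rightarrow> real" where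
  "W11_norm \<Omega> u =
     (LINT z:\<Omega>|lebesgue. \<bar>u z\<bar>) + (LINT z:\<Omega>|lebesgue. norm (weak_grad \<Omega> u z))"

definition half_space :: "('a::euclidean_space \<times> real) set" where
  "half_space = {(x, y). y > 0}"

text \<open>The trace operator from \<open>W\<^sup>1\<^sup>,\<^sup>1\<close> of the half-space to \<open>L\<^sup>1\<close> of the boundary is the continuous
  extension of \<open>v \<mapsto> v(\<cdot>, 0)\<close> from the dense subspace of restrictions of smooth compactly
  supported functions on the whole space (which need not vanish on the boundary).\<close>

definition has_trace ::
    "('a::euclidean_space \<times> real \<Rightarrow> real) \<Rightarrow> ('a \<Rightarrow> real) \<Rightarrow> bool" where
  "has_trace u t \<longleftrightarrow>
     u \<in> W11 half_space \<and> t absolutely_integrable_on UNIV \<and>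
     (\<exists>v. (\<forall>k::nat. test_fun UNIV (v k)) \<and>
        (\<lambda>k. W11_norm half_space (\<lambda>z. v k z - u z)) \<longlonglongrightarrow> 0 \<and>
        (\<lambda>k. LINT x|lebesgue. \<bar>v k (x, 0) - t x\<bar>) \<longlonglongrightarrow> 0)"

definition bd_trace :: "('a::euclidean_space \<times> real \<Rightarrow> real) \<Rightarrow> 'a \<Rightarrow> real" where
  "bd_trace u = (SOME t. has_trace u t)"

definition J :: "('a::euclidean_space \<times> real \<Rightarrow> real) \<Rightarrow> ereal" where
  "J u = (if AE x in lebesgue. bd_trace u x = 0 then \<infinity>
          else ereal ((LINT z:half_space|lebesgue. norm (weak_grad half_space u z)) /
                      (LINT x|lebesgue. \<bar>bd_trace u x\<bar>)))"

end

theory Submission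
  imports Defs
begin

text \<open>If \<open>v\<close> is smooth with compact support, then \<open>v(x,0) = - \<integral>\<^sub>0\<^sup>\<infinity> \<partial>\<^sub>y v(x,y) dy\<close>.  Mollifying with a
  kernel supported in the lower half-space and cutting off shows that such functions are dense in
  \<open>W\<^sup>1\<^sup>,\<^sup>1\<close>, so the trace of any \<open>u\<close> is \<open>- \<integral>\<^sub>0\<^sup>\<infinity> g\<^sub>y(x,y) dy\<close> with \<open>g\<close> the weak gradient, and \<open>J u \<ge> 1\<close>
  follows by Fubini; the same mollification gives the uniqueness of \<open>g\<close>.  Conversely, for a radially
  decreasing bump \<open>\<eta>\<close> the functions \<open>\<eta>(x, c y)\<close> are decreasing in \<open>y\<close> and have the same trace for all
  \<open>c\<close>, so \<open>\<integral>\<bar>\<partial>\<^sub>y\<bar>\<close> equals the integral of the trace, while the horizontal derivatives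
  tend to \<open>0\<close> in \<open>L\<^sup>1\<close> as \<open>c \<rightarrow> \<infinity>\<close>.\<close>

section \<open>Smooth functions and test functions\<close>

text \<open>\<open>J\<close> goes through two arbitrary choices, of a weak gradient and of a trace,
  so it says nothing until both are known to exist and to be unique almost everywhere. One estimate
  settles the trace: for a test function v, the L^1 distance from v(.,0) to minus the vertical
  integral of the weak derivative is at most the W^{1,1} distance from v to u. Applied to
  approximating sequences it gives existence and uniqueness alike. Density is therefore the real
  work, and its obstacle is the boundary: a centred kernel would ask for values of u below it. A
  second obstacle is measurability: the definitions integrate over completed Lebesgue measure, while
  Fubini wants Borel functions on a product, so each function is traded for a Borel representative
  on the whole space whose values off the half-space never matter. The horizontal derivatives of the
  squeezed bumps need no explicit integral: their supports collapse onto the boundary.\<close>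

abbreviation pd :: "'a::euclidean_space \<Rightarrow> ('a \<Rightarrow> real) \<Rightarrow> 'a \<Rightarrow> real" where
  "pd i f z \<equiv> frechet_derivative f (at z) i"

lemma pd_eq: "(f has_derivative f') (at z) \<Longrightarrow> pd i f z = f' i"
  by (metis frechet_derivative_at)

lemma pd_has_derivative:
  "f differentiable (at z) \<Longrightarrow> (f has_derivative (\<lambda>h. pd h f z)) (at z)"
  using frechet_derivative_works by metis

lemma pd_mult:
  assumes "f differentiable (at z)" "g differentiable (at z)"
  shows "pd i (\<lambda>z. f z * g z) z = f z * pd i g z + pd i f z * g z"
  by (rule pd_eq, rule has_derivative_mult) (intro pd_has_derivative assms)+

text \<open>Smoothness is phrased through basis directions only; linearity of the derivative in its
  direction extends that control to all directions.\<close>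

lemma pd_basis_sum:
  fixes f :: "'a::euclidean_space \<Rightarrow> real"
  assumes "f differentiable (at z)"
  shows "pd h f z = (\<Sum>j\<in>Basis. (h \<bullet> j) * pd j f z)"
proof -
  interpret linear "\<lambda>h. pd h f z"
    using pd_has_derivative[OF assms] has_derivative_linear by blast
  have "pd h f z = pd (\<Sum>j\<in>Basis. (h \<bullet> j) *\<^sub>R j) f z"
    by (simp add: euclidean_representation)
  also have "\<dots> = (\<Sum>j\<in>Basis. (h \<bullet> j) * pd j f z)"
    by (subst sum) (simp add: scale)
  finally show ?thesis .
qed

section \<open>Calculus of C^k and smooth functions\<close>

lemma Ck_SucD: "Ck (Suc k) f \<Longrightarrow> Ck k f"
proof (induction k arbitrary: f)
  case 0
  then show ?case
    by (auto intro!: continuous_at_imp_continuous_on differentiable_imp_continuous_within)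
next
  case (Suc k)
  \<comment> \<open>Premise and goal are unfolded exactly once: the partials in the premise are
    C^(k+1), and the induction hypothesis lowers each of them to C^k.\<close>
  from Suc.prems show ?case
    by (subst Ck.simps(2)) (simp only: Ck.simps(2)[of "Suc k" f], blast intro: Suc.IH)
qed

lemma Ck_const: "Ck k (\<lambda>z. c)"
  by (induction k arbitrary: c) auto

lemma Ck_add: "Ck k f \<Longrightarrow> Ck k g \<Longrightarrow> Ck k (\<lambda>z. f z + g z)"
proof (induction k arbitrary: f g)
  case (Suc k)
  have "pd i (\<lambda>z. f z + g z) z = pd i f z + pd i g z" for i z
    using Suc.prems by (intro pd_eq has_derivative_add pd_has_derivative) auto
  then show ?case using Suc by (auto intro!: derivative_intros)
qed (auto intro: continuous_intros)

lemma Ck_sum: "finite S \<Longrightarrow> (\<And>j. j \<in> S \<Longrightarrow> Ck k (f j)) \<Longrightarrow> Ck k (\<lambda>z. \<Sum>j\<in>S. f j z)"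
  by (induction S rule: finite_induct) (auto intro: Ck_const Ck_add)

lemma Ck_mult: "Ck k f \<Longrightarrow> Ck k g \<Longrightarrow> Ck k (\<lambda>z. f z * g z)"
proof (induction k arbitrary: f g)
  case (Suc k)
  have "pd i (\<lambda>z. f z * g z) z = f z * pd i g z + pd i f z * g z" for i z
    using Suc.prems by (intro pd_mult) auto
  moreover have "Ck k f" "Ck k g" using Suc.prems Ck_SucD by blast+
  ultimately show ?case using Suc by (auto intro!: derivative_intros Ck_add)
qed (auto intro: continuous_intros)

text \<open>By the chain rule the i-th partial of the composite is the derivative of f in direction
  \<open>L i\<close>, which need not be a basis vector. Expanding it over the basis gives a constant
  combination of partials of f after the same map, to which the induction hypothesis
  applies.\<close>

lemma Ck_affine:
  assumes L: "bounded_linear L" and "Ck k f"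
  shows "Ck k (\<lambda>z. f (c + L z))"
  using assms(2)
proof (induction k arbitrary: f)
  case 0
  have "continuous_on UNIV (\<lambda>z. c + L z)"
    by (intro continuous_intros linear_continuous_on L)
  then show ?case using 0 continuous_on_compose2[of UNIV f UNIV "\<lambda>z. c + L z"] by auto
next
  case (Suc k)
  have D: "((\<lambda>z. f (c + L z)) has_derivative (\<lambda>h. pd (L h) f (c + L z))) (at z)" for z
  proof (rule has_derivative_compose[where f="\<lambda>z. c + L z" and g'="\<lambda>h. pd h f (c + L z)"])
    show "((\<lambda>z. c + L z) has_derivative L) (at z)"
      by (auto intro!: derivative_eq_intros bounded_linear.has_derivative[OF L])
    show "(f has_derivative (\<lambda>h. pd h f (c + L z))) (at (c + L z))"
      using Suc.prems by (intro pd_has_derivative) auto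
  qed
  have "pd i (\<lambda>z. f (c + L z)) z = (\<Sum>j\<in>Basis. (L i \<bullet> j) * pd j f (c + L z))" for i z
    using Suc.prems by (subst pd_eq[OF D], subst pd_basis_sum) auto
  moreover have "Ck k (\<lambda>z. \<Sum>j\<in>Basis. (L i \<bullet> j) * pd j f (c + L z))" for i
    using Suc by (intro Ck_sum Ck_mult Ck_const) auto
  ultimately show ?case using D by (simp, blast intro: differentiableI)
qed

lemma smooth_const [simp]: "smooth (\<lambda>z. c)"
  by (simp add: smooth_def Ck_const)

lemma smooth_add: "smooth f \<Longrightarrow> smooth g \<Longrightarrow> smooth (\<lambda>z. f z + g z)"
  by (simp add: smooth_def Ck_add)

lemma smooth_sum: "finite S \<Longrightarrow> (\<And>j. j \<in> S \<Longrightarrow> smooth (f j)) \<Longrightarrow> smooth (\<lambda>z. \<Sum>j\<in>S. f j z)"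
  by (simp add: smooth_def Ck_sum)

lemma smooth_mult: "smooth f \<Longrightarrow> smooth g \<Longrightarrow> smooth (\<lambda>z. f z * g z)"
  by (simp add: smooth_def Ck_mult)

lemma smooth_affine: "bounded_linear L \<Longrightarrow> smooth f \<Longrightarrow> smooth (\<lambda>z. f (c + L z))"
  by (simp add: smooth_def Ck_affine)

lemma smooth_iff:
  "smooth f \<longleftrightarrow> (\<forall>z. f differentiable (at z)) \<and> (\<forall>i\<in>Basis. smooth (pd i f))"
  unfolding smooth_def by (metis Ck.simps(2) Ck_SucD not0_implies_Suc)

lemma smooth_differentiable: "smooth f \<Longrightarrow> f differentiable (at z)"
  using smooth_iff by blast

lemma smooth_pd: "smooth f \<Longrightarrow> i \<in> Basis \<Longrightarrow> smooth (pd i f)"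
  using smooth_iff by blast

lemma smooth_continuous: "smooth f \<Longrightarrow> continuous_on S f"
  unfolding smooth_def using Ck.simps(1) continuous_on_subset by blast

lemma smooth_measurable [measurable_dest]: "smooth f \<Longrightarrow> f \<in> borel_measurable borel"
  by (simp add: smooth_continuous borel_measurable_continuous_onI)

lemma smooth_inner: "smooth (\<lambda>z. z \<bullet> a)"
proof -
  have "((\<lambda>z. z \<bullet> a) has_derivative (\<lambda>h. h \<bullet> a)) (at z)" for z :: 'a
    by (auto intro!: derivative_eq_intros)
  then have "(\<lambda>z. pd i (\<lambda>z. z \<bullet> a) z) = (\<lambda>z. i \<bullet> a)" for i :: 'a
    using pd_eq by blast
  then show ?thesis by (subst smooth_iff) (auto intro!: derivative_intros)
qed

text \<open>A partial of \<open>F j\<close> after h is \<open>F (Suc j)\<close> after h times a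
  partial of h, so order k + 1 at j rests on order k at j + 1; hence the induction keeps j
  arbitrary.\<close>

lemma smooth_chain:
  fixes F :: "nat \<Rightarrow> real \<Rightarrow> real"
  assumes F: "\<And>j x. (F j has_real_derivative F (Suc j) x) (at x)" and h: "smooth h"
  shows "smooth (\<lambda>z. F j (h z))"
proof -
  have D: "((\<lambda>z. F j (h z)) has_derivative (\<lambda>v. F (Suc j) (h z) * pd v h z)) (at z)" for j z
    by (rule DERIV_compose_FDERIV[OF F pd_has_derivative, THEN has_derivative_eq_rhs])
       (auto simp: smooth_differentiable[OF h] mult.commute)
  have "Ck k (\<lambda>z. F j (h z))" for k
  proof (induction k arbitrary: j)
    case 0
    have "(\<lambda>z. F j (h z)) differentiable (at z)" for z
      using D by (rule differentiableI)
    then show ?case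
      by (auto intro!: continuous_at_imp_continuous_on differentiable_imp_continuous_within)
  next
    case (Suc k)
    have "pd i (\<lambda>z. F j (h z)) = (\<lambda>z. F (Suc j) (h z) * pd i h z)" for i
      using pd_eq[OF D] by blast
    moreover have "Ck k (\<lambda>z. F (Suc j) (h z) * pd i h z)" if "i \<in> Basis" for i
      using Suc smooth_pd[OF h that] by (auto intro!: Ck_mult simp: smooth_def)
    ultimately show ?case using D by (simp, blast intro: differentiableI)
  qed
  then show ?thesis by (simp add: smooth_def)
qed

section \<open>Test functions\<close>

lemma test_funI:
  "smooth f \<Longrightarrow> compact K \<Longrightarrow> K \<subseteq> \<Omega> \<Longrightarrow> (\<And>z. z \<notin> K \<Longrightarrow> f z = 0) \<Longrightarrow> test_fun \<Omega> f"
  unfolding test_fun_def by blast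

lemma test_fun_smooth: "test_fun \<Omega> f \<Longrightarrow> smooth f"
  by (simp add: test_fun_def)

lemma test_fun_mono: "test_fun \<Omega> f \<Longrightarrow> \<Omega> \<subseteq> \<Omega>' \<Longrightarrow> test_fun \<Omega>' f"
  unfolding test_fun_def by blast

lemma test_fun_mult: "test_fun \<Omega> f \<Longrightarrow> smooth g \<Longrightarrow> test_fun \<Omega> (\<lambda>z. g z * f z)"
  unfolding test_fun_def using smooth_mult by force

text \<open>The complement of K is open, so f is locally zero at z. Hence partials of a test
  function keep its compact support.\<close>

lemma pd_eq_0_outside:
  assumes "closed K" "\<And>z. z \<notin> K \<Longrightarrow> f z = 0" "z \<notin> K"
  shows "pd i f z = 0"
proof -
  have "((\<lambda>_. 0) has_derivative (\<lambda>_. 0)) (at z)" by simp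
  then have "(f has_derivative (\<lambda>_. 0)) (at z)"
    by (rule has_derivative_transform_within_open[of _ _ _ _ "- K"]) (use assms in auto)
  then show ?thesis by (rule pd_eq)
qed

lemma test_fun_pd: "test_fun \<Omega> f \<Longrightarrow> i \<in> Basis \<Longrightarrow> test_fun \<Omega> (pd i f)"
  unfolding test_fun_def using smooth_pd pd_eq_0_outside compact_imp_closed by metis

lemma test_fun_integrable:
  assumes "test_fun \<Omega> f" shows "integrable lborel f"
proof -
  obtain K where K: "compact K" "\<And>z. z \<notin> K \<Longrightarrow> f z = 0"
    using assms unfolding test_fun_def by blast
  have "integrable lborel (\<lambda>z. indicator K z *\<^sub>R f z)"
    using assms K by (intro borel_integrable_compact smooth_continuous test_fun_smooth) auto
  moreover have "(\<lambda>z. indicator K z *\<^sub>R f z) = f" using K by (intro ext) (auto simp: indicator_def)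
  ultimately show ?thesis by simp
qed

lemma test_fun_bounded:
  assumes "test_fun \<Omega> f"
  obtains B where "B > 0" "\<And>z. \<bar>f z\<bar> \<le> B"
proof -
  obtain K where K: "compact K" "\<And>z. z \<notin> K \<Longrightarrow> f z = 0"
    using assms unfolding test_fun_def by blast
  have "bounded (f ` K)"
    using test_fun_smooth[OF assms]
    by (intro compact_imp_bounded compact_continuous_image K smooth_continuous)
  then obtain B where "B > 0" "\<And>z. z \<in> K \<Longrightarrow> \<bar>f z\<bar> \<le> B"
    by (auto simp: bounded_pos)
  then show ?thesis using that[of B] K by (metis abs_zero less_imp_le)
qed

text \<open>The family over all polynomials \<open>p\<close> is closed under differentiation.\<close>

definition flat_exp :: "real poly \<Rightarrow> real \<Rightarrow> real" where
  "flat_exp p x = (if x > 0 then poly p (1 / x) * exp (- (1 / x)) else 0)"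

text \<open>Exponential decay beats each monomial; with s = 1 / x this is the flatness of
  \<open>flat_exp\<close> at the origin from the right.\<close>

lemma poly_exp_decay: "((\<lambda>s::real. poly p s * exp (- s)) \<longlongrightarrow> 0) at_top"
proof -
  have "((\<lambda>s. \<Sum>i\<le>degree p. coeff p i * (s ^ i / exp s)) \<longlongrightarrow> (\<Sum>i\<le>degree p. coeff p i * 0)) at_top"
    by (intro tendsto_intros tendsto_power_div_exp_0)
  moreover have "(\<lambda>s. \<Sum>i\<le>degree p. coeff p i * (s ^ i / exp s)) = (\<lambda>s. poly p s * exp (- s))"
    by (intro ext) (simp add: poly_altdef exp_minus divide_inverse sum_distrib_right mult.assoc)
  ultimately show ?thesis by simp
qed

text \<open>For x > 0 put s = 1 / x: differentiating p(s) exp(-s) brings out ds/dx = -s^2 and gives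
  s^2 (p - p')(s) exp(-s); \<open>[:0, 0, 1:]\<close> is the polynomial s^2.\<close>

lemma flat_exp_deriv:
  "(flat_exp p has_real_derivative flat_exp ([:0, 0, 1:] * (p - pderiv p)) x) (at x)"
proof -
  consider "x > 0" | "x < 0" | "x = 0" by linarith
  then show ?thesis
  proof cases
    case 1
    have "((\<lambda>x. poly p (1 / x) * exp (- (1 / x))) has_real_derivative
        flat_exp ([:0, 0, 1:] * (p - pderiv p)) x) (at x)"
    proof (rule DERIV_cong)
      show "((\<lambda>x. poly p (1 / x) * exp (- (1 / x))) has_real_derivative
          (poly (pderiv p) (1 / x) * (- 1 / x\<^sup>2)) * exp (- (1 / x)) +
          poly p (1 / x) * (exp (- (1 / x)) * (1 / x\<^sup>2))) (at x)"
        using 1 by (auto intro!: derivative_eq_intros DERIV_chain2[where f="poly p"] poly_DERIV simp: power2_eq_square)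
    qed (use 1 in \<open>simp add: flat_exp_def divide_simps power2_eq_square\<close>, simp add: algebra_simps)
    then show ?thesis
      by (rule has_field_derivative_transform_within_open[where S="{0<..}"])
         (use 1 in \<open>auto simp: flat_exp_def\<close>)
  next
    case 2
    have "((\<lambda>x. 0) has_real_derivative flat_exp ([:0, 0, 1:] * (p - pderiv p)) x) (at x)"
      using 2 by (simp add: flat_exp_def)
    then show ?thesis
      by (rule has_field_derivative_transform_within_open[where S="{..<0}"])
         (use 2 in \<open>auto simp: flat_exp_def\<close>)
  next
    case 3
    \<comment> \<open>At 0 the right difference quotient is s p(s) exp(-s) with s = 1 / y, an
      expression of the same kind with \<open>pCons 0 p\<close> in place of p.\<close>
    have "((\<lambda>y. flat_exp p y / y) \<longlongrightarrow> 0) (at_right 0)"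
    proof (rule Lim_transform_eventually)
      show "((\<lambda>y. poly (pCons 0 p) (inverse y) * exp (- inverse y)) \<longlongrightarrow> 0) (at_right (0::real))"
        by (rule filterlim_compose[OF poly_exp_decay filterlim_inverse_at_top_right])
      show "\<forall>\<^sub>F y in at_right 0. poly (pCons 0 p) (inverse y) * exp (- inverse y) = flat_exp p y / y"
        by (rule eventually_at_rightI[of 0 1]) (auto simp: flat_exp_def field_simps)
    qed
    moreover have "((\<lambda>y. flat_exp p y / y) \<longlongrightarrow> 0) (at_left 0)"
    proof (rule Lim_transform_eventually)
      show "((\<lambda>y. 0) \<longlongrightarrow> 0) (at_left (0::real))" by simp
      show "\<forall>\<^sub>F y in at_left 0. 0 = flat_exp p y / y"
        by (rule eventually_at_leftI[of "-1"]) (auto simp: flat_exp_def)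
    qed
    ultimately have "((\<lambda>y. flat_exp p y / y) \<longlongrightarrow> 0) (at 0)"
      by (simp add: filterlim_split_at)
    then show ?thesis using 3 by (simp add: has_field_derivative_iff flat_exp_def)
  qed
qed

lemma smooth_flat_exp: "smooth h \<Longrightarrow> smooth (\<lambda>z. flat_exp p (h z))"
proof -
  define F where "F j = flat_exp (((\<lambda>p. [:0, 0, 1:] * (p - pderiv p)) ^^ j) p)" for j
  have "(F j has_real_derivative F (Suc j) x) (at x)" for j x
    unfolding F_def funpow.simps o_apply by (rule flat_exp_deriv)
  moreover assume "smooth h"
  ultimately have "smooth (\<lambda>z. F 0 (h z))" by (rule smooth_chain)
  then show ?thesis by (simp add: F_def)
qed

section \<open>The radial bump exp(-1/(1 - |z|^2)) on the unit ball\<close>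

definition bump :: "'a::euclidean_space \<Rightarrow> real" where
  "bump z = flat_exp [:1:] (1 - z \<bullet> z)"

lemma smooth_bump: "smooth bump"
proof -
  have "smooth (\<lambda>z::'a. 1 + (\<Sum>i\<in>Basis. (-1) * ((z \<bullet> i) * (z \<bullet> i))))"
    by (intro smooth_add smooth_sum smooth_mult smooth_const smooth_inner) auto
  then have "smooth (\<lambda>z::'a. flat_exp [:1:] (1 + (\<Sum>i\<in>Basis. (-1) * ((z \<bullet> i) * (z \<bullet> i)))))"
    by (rule smooth_flat_exp)
  moreover have "1 + (\<Sum>i\<in>Basis. (-1) * ((z \<bullet> i) * (z \<bullet> i))) = 1 - z \<bullet> z" for z :: 'a
    using euclidean_inner[of z z] by (simp add: sum_negf)
  ultimately show ?thesis by (simp add: bump_def[abs_def])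
qed

lemma bump_nonneg: "bump z \<ge> 0"
  by (simp add: bump_def flat_exp_def)

lemma bump_eq_0: "norm z \<ge> 1 \<Longrightarrow> bump z = 0"
  using one_le_power[of "norm z" 2]
  by (auto simp: bump_def flat_exp_def power2_norm_eq_inner[symmetric] simp del: one_le_power)

lemma bump_pos: "norm z < 1 \<Longrightarrow> bump z > 0"
  by (simp add: bump_def flat_exp_def power2_norm_eq_inner[symmetric] abs_square_less_1)

text \<open>Inside the ball 1/(1 - |z|^2) grows with |z|, and outside the value is 0. In particular
  the maximum is at the origin, which normalises the cut-off functions later.\<close>

lemma bump_antimono: "norm w \<le> norm z \<Longrightarrow> bump z \<le> bump w"
proof -
  assume "norm w \<le> norm z"
  then have "w \<bullet> w \<le> z \<bullet> z" by (simp add: norm_le)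
  moreover have "1 / (1 - w \<bullet> w) \<le> 1 / (1 - z \<bullet> z)" if "z \<bullet> z < 1"
    using \<open>w \<bullet> w \<le> z \<bullet> z\<close> that by (intro divide_left_mono mult_pos_pos) linarith+
  ultimately show ?thesis unfolding bump_def flat_exp_def by auto
qed

lemma test_fun_bump: "test_fun UNIV bump"
  by (rule test_funI[OF smooth_bump compact_cball[of 0 1]]) (auto intro: bump_eq_0)

section \<open>Integration by parts\<close>

lemma measure_preserving_shift: "distr lborel borel (\<lambda>w::'a::euclidean_space. w + h) = lborel"
  using lborel_distr_plus[of h] by (simp add: add.commute[of _ h])

lemma measure_preserving_reflect: "distr lborel borel (\<lambda>w::'a::euclidean_space. z - w) = lborel"
  by (subst lborel_affine[of "-1" z]) (auto simp: density_1)

lemma integral_shift: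
  fixes f :: "'a::euclidean_space \<Rightarrow> real"
  assumes "f \<in> borel_measurable borel"
  shows "(LINT w|lborel. f (w + h)) = (LINT w|lborel. f w)"
  using integral_distr[of "\<lambda>w. w + h" lborel borel f] assms
  by (simp add: measure_preserving_shift)

lemma integrable_shift:
  fixes f :: "'a::euclidean_space \<Rightarrow> real"
  assumes "integrable lborel f"
  shows "integrable lborel (\<lambda>w. f (w + h))"
  using integrable_distr_eq[of "\<lambda>w. w + h" lborel borel f] assms
  by (simp add: measure_preserving_shift)

lemma integral_reflect:
  fixes f :: "'a::euclidean_space \<Rightarrow> real"
  assumes "f \<in> borel_measurable borel"
  shows "(LINT w|lborel. f (z - w)) = (LINT w|lborel. f w)"
  using integral_distr[of "\<lambda>w. z - w" lborel borel f] assms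
  by (simp add: measure_preserving_reflect)

text \<open>Each basis partial is itself a test function, hence bounded; summing the finitely many
  bounds controls every direction, and the mean value inequality yields a Lipschitz bound with the
  same constant. These constants later dominate difference quotients.\<close>

lemma test_fun_derivative_bound:
  fixes f :: "'a::euclidean_space \<Rightarrow> real"
  assumes f: "test_fun \<Omega> f"
  obtains B where "B > 0" "\<And>h z. \<bar>pd h f z\<bar> \<le> B * norm h" "\<And>x y. \<bar>f x - f y\<bar> \<le> B * norm (x - y)"
proof -
  note [simp] = smooth_differentiable[OF test_fun_smooth[OF f]]
  have "\<forall>j\<in>Basis. \<exists>B. \<forall>z. \<bar>pd j f z\<bar> \<le> B"
    using test_fun_bounded[OF test_fun_pd[OF f]] by meson
  then obtain b where b: "\<And>j z. j \<in> Basis \<Longrightarrow> \<bar>pd j f z\<bar> \<le> b j" by metis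
  \<comment> \<open>The summand 1 keeps B positive when all partials vanish.\<close>
  define B where "B = 1 + (\<Sum>j\<in>Basis. b j)"
  have "b j \<ge> 0" if "j \<in> Basis" for j using b[OF that, of 0] by linarith
  then have B: "B > 0" unfolding B_def by (smt (verit) sum_nonneg)
  have pd: "\<bar>pd h f z\<bar> \<le> B * norm h" for h z
  proof -
    have "\<bar>pd h f z\<bar> \<le> (\<Sum>j\<in>Basis. \<bar>(h \<bullet> j) * pd j f z\<bar>)"
      by (subst pd_basis_sum) (auto intro: sum_abs)
    also have "\<dots> \<le> (\<Sum>j\<in>Basis. norm h * b j)"
      unfolding abs_mult by (intro sum_mono mult_mono b Basis_le_norm) auto
    also have "\<dots> \<le> B * norm h"
      by (simp add: B_def sum_distrib_left[symmetric] algebra_simps)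
    finally show ?thesis .
  qed
  have "\<bar>f x - f y\<bar> \<le> B * norm (x - y)" for x y
  proof -
    have "onorm (\<lambda>h. pd h f z) \<le> B" for z
      using pd B by (intro onorm_bound) auto
    then show ?thesis
      using differentiable_bound[of UNIV f "\<lambda>z h. pd h f z" B x y] pd_has_derivative[of f] by simp
  qed
  with B pd show ?thesis using that by blast
qed

text \<open>Translation invariance makes the difference quotients have integral zero.\<close>

lemma integral_pd_test_fun:
  fixes f :: "'a::euclidean_space \<Rightarrow> real"
  assumes f: "test_fun \<Omega> f" and i: "i \<in> Basis"
  shows "(LINT z|lborel. pd i f z) = 0"
proof -
  obtain K where K: "compact K" "\<And>z. z \<notin> K \<Longrightarrow> f z = 0"
    using f unfolding test_fun_def by blast
  obtain R where R: "\<And>z. z \<in> K \<Longrightarrow> norm z \<le> R"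
    using compact_imp_bounded[OF K(1)] by (auto simp: bounded_iff)
  obtain B where B: "B > 0" "\<And>x y. \<bar>f x - f y\<bar> \<le> B * norm (x - y)"
    using test_fun_derivative_bound[OF f] by metis
  have [measurable]: "f \<in> borel_measurable borel" "pd i f \<in> borel_measurable borel"
    using test_fun_smooth[OF f] i by (auto intro!: smooth_measurable smooth_pd)
  define h where "h n = inverse (real (Suc n))" for n
  \<comment> \<open>Steps of length at most 1 keep the support of every difference quotient inside
    the ball of radius R + 1, so one dominating function serves all n.\<close>
  have h: "h n > 0" "h n \<le> 1" for n by (auto simp: h_def field_simps)
  define q where "q n z = (f (z + h n *\<^sub>R i) - f z) / h n" for n z
  have q0: "(LINT z|lborel. q n z) = 0" for n
    using integral_shift[of f "h n *\<^sub>R i"] integrable_shift[OF test_fun_integrable[OF f], of "h n *\<^sub>R i"]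
      test_fun_integrable[OF f] by (simp add: q_def)
  have "(\<lambda>n. LINT z|lborel. q n z) \<longlonglongrightarrow> (LINT z|lborel. pd i f z)"
  proof (rule integral_dominated_convergence[where w="\<lambda>z. B * indicator (cball 0 (R + 1)) z"])
    show "integrable lborel (\<lambda>z::'a. B * indicator (cball 0 (R + 1)) z)"
      using emeasure_compact_finite[of "cball (0::'a) (R+1)"]
      by (auto intro!: integrable_mult_right integrable_real_indicator)
    show "AE z in lborel. (\<lambda>n. q n z) \<longlonglongrightarrow> pd i f z"
    proof (rule AE_I2)
      fix z
      have "((\<lambda>t. z + t *\<^sub>R i) has_derivative (\<lambda>t. t *\<^sub>R i)) (at 0)"
        by (auto intro!: derivative_eq_intros)
      from has_derivative_compose[OF this, of f "\<lambda>h. pd h f z"]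
      have D: "((\<lambda>t. f (z + t *\<^sub>R i)) has_derivative (\<lambda>t. pd (t *\<^sub>R i) f z)) (at 0)"
        using pd_has_derivative[OF smooth_differentiable[OF test_fun_smooth[OF f]]] by simp
      have "(\<lambda>t. pd (t *\<^sub>R i) f z) = (*) (pd i f z)"
        using linear_scale[OF has_derivative_linear[OF pd_has_derivative[OF
              smooth_differentiable[OF test_fun_smooth[OF f]]]]]
        by (auto simp: mult.commute)
      then have "((\<lambda>t. f (z + t *\<^sub>R i)) has_real_derivative pd i f z) (at 0)"
        using D by (simp add: has_field_derivative_def)
      then have "((\<lambda>t. (f (z + t *\<^sub>R i) - f z) / t) \<longlongrightarrow> pd i f z) (at 0)"
        by (simp add: has_field_derivative_iff)
      moreover have "filterlim h (at 0) sequentially"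
        unfolding h_def by (rule filterlim_atI[OF LIMSEQ_inverse_real_of_nat]) auto
      ultimately show "(\<lambda>n. q n z) \<longlonglongrightarrow> pd i f z"
        unfolding q_def by (rule filterlim_compose)
    qed
    show "AE z in lborel. norm (q n z) \<le> B * indicator (cball 0 (R + 1)) z" for n
    proof (rule AE_I2)
      fix z
      show "norm (q n z) \<le> B * indicator (cball 0 (R + 1)) z"
      proof (cases "norm z \<le> R + 1")
        case True
        have "\<bar>f (z + h n *\<^sub>R i) - f z\<bar> \<le> B * h n"
          using B(2)[of "z + h n *\<^sub>R i" z] h(1)[of n] i by simp
        then show ?thesis using True h(1)[of n] by (simp add: q_def divide_simps)
      next
        case False
        have "norm z \<le> norm (z + h n *\<^sub>R i) + h n"
          using norm_triangle_ineq4[of "z + h n *\<^sub>R i" "h n *\<^sub>R i"] h(1)[of n] i by simp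
        then have "norm z > R" "norm (z + h n *\<^sub>R i) > R"
          using False h(2)[of n] by linarith+
        then have "f z = 0" "f (z + h n *\<^sub>R i) = 0" using K(2) R by force+
        then show ?thesis using False by (simp add: q_def)
      qed
    qed
  qed (auto simp: q_def)
  then show ?thesis using q0 LIMSEQ_const_iff[of "0::real"] by simp
qed

text \<open>The product of a smooth function with a test function is a test function, so its
  partials integrate to zero; the product rule splits that integral.\<close>

lemma integral_by_parts_test_fun:
  fixes f :: "'a::euclidean_space \<Rightarrow> real"
  assumes f: "smooth f" and \<phi>: "test_fun \<Omega> \<phi>" and i: "i \<in> Basis"
  shows "(LINT z|lborel. f z * pd i \<phi> z) = - (LINT z|lborel. pd i f z * \<phi> z)"
proof -
  have I: "integrable lborel (\<lambda>z. f z * pd i \<phi> z)" "integrable lborel (\<lambda>z. pd i f z * \<phi> z)"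
    using test_fun_integrable[OF test_fun_mult[OF test_fun_pd[OF \<phi> i] f]]
      test_fun_integrable[OF test_fun_mult[OF \<phi> smooth_pd[OF f i]]] by auto
  have "(LINT z|lborel. pd i (\<lambda>z. f z * \<phi> z) z) = 0"
    by (rule integral_pd_test_fun[OF test_fun_mult[OF \<phi> f] i])
  moreover have "pd i (\<lambda>z. f z * \<phi> z) z = f z * pd i \<phi> z + pd i f z * \<phi> z" for z
    by (intro pd_mult smooth_differentiable f test_fun_smooth[OF \<phi>])
  ultimately show ?thesis using I by simp
qed

section \<open>Completed versus Borel measure; classical gradients as weak gradients\<close>

lemma lebesgue_eq_lborel_integral:
  fixes f :: "'a::euclidean_space \<Rightarrow> real"
  assumes "f \<in> borel_measurable borel" "\<And>z. z \<notin> \<Omega> \<Longrightarrow> f z = 0"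
  shows "(LINT z:\<Omega>|lebesgue. f z) = (LINT z|lborel. f z)"
proof -
  have "(\<lambda>z. indicator \<Omega> z *\<^sub>R f z) = f"
  proof
    show "indicator \<Omega> z *\<^sub>R f z = f z" for z using assms(2) by (cases "z \<in> \<Omega>") auto
  qed
  then show ?thesis
    using assms(1) by (simp only: set_lebesgue_integral_def) (simp add: integral_completion)
qed

lemma lborel_integrable_imp_absolutely_integrable:
  fixes f :: "'a::euclidean_space \<Rightarrow> 'b::euclidean_space"
  assumes "integrable lborel f" "\<Omega> \<in> sets borel"
  shows "f absolutely_integrable_on \<Omega>"
proof -
  have "integrable lborel (\<lambda>z. indicator \<Omega> z *\<^sub>R f z)"
    using assms integrable_mult_indicator[of \<Omega> lborel f] by simp
  then show ?thesis
    unfolding set_integrable_def by (subst integrable_completion) auto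
qed

definition grad :: "('a::euclidean_space \<Rightarrow> real) \<Rightarrow> 'a \<Rightarrow> 'a" where
  "grad f z = (\<Sum>i\<in>Basis. pd i f z *\<^sub>R i)"

lemma grad_inner [simp]: "i \<in> Basis \<Longrightarrow> grad f z \<bullet> i = pd i f z"
  by (simp add: grad_def inner_sum_left inner_Basis if_distrib[of "\<lambda>x. _ * x"] cong: if_cong)

text \<open>The test function and its partials vanish outside \<Omega>, so both set integrals are
  integrals over the whole space and no boundary term arises.\<close>

lemma has_weak_grad_smooth:
  fixes f :: "'a::euclidean_space \<Rightarrow> real"
  assumes f: "smooth f" "integrable lborel f" "\<And>i. i \<in> Basis \<Longrightarrow> integrable lborel (pd i f)"
    and \<Omega>: "\<Omega> \<in> sets borel"
  shows "has_weak_grad \<Omega> f (grad f)"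
  unfolding has_weak_grad_def
proof (intro conjI allI impI ballI)
  show "f absolutely_integrable_on \<Omega>"
    by (rule lborel_integrable_imp_absolutely_integrable[OF f(2) \<Omega>])
  have "integrable lborel (grad f)"
    unfolding grad_def using f(3) by (intro Bochner_Integration.integrable_sum integrable_scaleR_left) auto
  then show "grad f absolutely_integrable_on \<Omega>"
    by (rule lborel_integrable_imp_absolutely_integrable[OF _ \<Omega>])
  fix \<phi> :: "'a \<Rightarrow> real" and i :: 'a
  assume \<phi>: "test_fun \<Omega> \<phi>" and i: "i \<in> Basis"
  have [measurable]: "f \<in> borel_measurable borel" "\<phi> \<in> borel_measurable borel"
      "pd i f \<in> borel_measurable borel" "pd i \<phi> \<in> borel_measurable borel"
    using test_fun_smooth[OF \<phi>] f(1) i by (auto intro!: smooth_measurable smooth_pd)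
  have 0: "\<phi> z = 0" "pd i \<phi> z = 0" if "z \<notin> \<Omega>" for z
    using that \<phi> test_fun_pd[OF \<phi> i] unfolding test_fun_def by auto
  show "(LINT z:\<Omega>|lebesgue. f z * pd i \<phi> z) = - (LINT z:\<Omega>|lebesgue. (grad f z \<bullet> i) * \<phi> z)"
    using integral_by_parts_test_fun[OF f(1) \<phi> i] i 0
    by (subst (1 2) lebesgue_eq_lborel_integral) auto
qed

section \<open>Mollification\<close>

lemma finite_measure_sandwich:
  fixes A :: "'a::euclidean_space set"
  assumes A: "A \<in> sets borel" "emeasure lborel A < \<infinity>" and e: "e > (0::real)"
  obtains K U where "compact K" "open U" "K \<subseteq> A" "A \<subseteq> U"
    "emeasure lborel (U - K) \<le> ennreal e"
proof -
  have "A \<in> sets lebesgue" "e / 2 > 0" using A e by simp_all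
  from sets_lebesgue_outer_open[OF this]
  obtain U where U: "open U" "A \<subseteq> U" "emeasure lebesgue (U - A) < ennreal (e / 2)" .
  \<comment> \<open>Restricting to A makes the total mass finite, as inner regularity by compact
    sets requires; \<open>lborel\<close> itself has infinite mass.\<close>
  define M where "M = density lborel (indicator A :: 'a \<Rightarrow> ennreal)"
  have M: "emeasure M B = emeasure lborel (A \<inter> B)" if "B \<in> sets borel" for B
    using that A by (simp add: M_def emeasure_density nn_integral_indicator' indicator_inter_arith[symmetric])
  have *: "(SUP K\<in>{K. K \<subseteq> A \<and> compact K}. emeasure M K) = emeasure M A"
    using A M by (intro inner_regular[symmetric]) (auto simp: M_def)
  have fin: "emeasure M A < \<infinity>" using A M by simp
  obtain K where K: "K \<subseteq> A" "compact K" "emeasure M A \<le> emeasure M K + ennreal (e / 2)"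
  proof -
    have "{K. K \<subseteq> A \<and> compact K} \<noteq> {}" by auto
    then obtain K where "K \<in> {K. K \<subseteq> A \<and> compact K}" "emeasure M A < emeasure M K + ennreal (e / 2)"
      using SUP_approx_ennreal[of "e/2" "{K. K \<subseteq> A \<and> compact K}" "emeasure M A" "emeasure M"] * fin e
      by (auto simp: less_top)
    then show ?thesis using that by auto
  qed
  have [measurable]: "K \<in> sets borel" "U \<in> sets borel" using K U by (auto intro: borel_compact)
  have "emeasure lborel A \<le> emeasure lborel K + ennreal (e / 2)"
    using K M[of A] M[of K] A by (simp add: Int_absorb1)
  moreover have "emeasure lborel (A - K) = emeasure lborel A - emeasure lborel K"
    using K A emeasure_compact_finite[OF K(2)] by (intro emeasure_Diff) auto
  ultimately have AK: "emeasure lborel (A - K) \<le> ennreal (e / 2)"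
    using ennreal_minus_le_iff[of "emeasure lborel A" "emeasure lborel K"] emeasure_compact_finite[OF K(2)]
    by (auto simp: add.commute)
  have "emeasure lborel (U - K) \<le> emeasure lborel ((U - A) \<union> (A - K))"
    using A by (intro emeasure_mono) auto
  also have "\<dots> \<le> emeasure lborel (U - A) + emeasure lborel (A - K)"
    using A by (intro emeasure_subadditive) auto
  also have "\<dots> \<le> ennreal (e / 2) + ennreal (e / 2)"
    using U(3) AK A by (intro add_mono) auto
  also have "\<dots> = ennreal e" using e by (simp add: ennreal_plus[symmetric] del: ennreal_plus)
  finally show ?thesis using that K U by blast
qed

text \<open>The property passes from indicators to sums and dominated limits, hence to all
  integrable functions. For an indicator, squeeze A between a compact K and an open U: a shift
  shorter than the distance from K to the complement of U changes it only on U - K and on a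
  translate of U - K.\<close>

lemma L1_translation_continuous:
  fixes f :: "'a::euclidean_space \<Rightarrow> real"
  assumes "integrable lborel f" "d > (0::real)"
  shows "\<exists>e>0. \<forall>h. norm h < e \<longrightarrow> (LINT z|lborel. \<bar>f (z + h) - f z\<bar>) \<le> d"
  using assms
proof (induction f arbitrary: d rule: integrable_induct)
  case (base A c)
  \<comment> \<open>The two copies of U - K contribute at most 2 |c| d'; the + 1 avoids dividing by
    zero when c = 0.\<close>
  define d' where "d' = d / (2 * (\<bar>c\<bar> + 1))"
  have d': "d' > 0" "2 * \<bar>c\<bar> * d' \<le> d" using base by (auto simp: d'_def field_simps)
  obtain K U where KU: "compact K" "open U" "K \<subseteq> A" "A \<subseteq> U" "emeasure lborel (U - K) \<le> ennreal d'"
    using finite_measure_sandwich[of A d'] base d' by auto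
  obtain e where e: "e > 0" "\<And>x y. x \<in> K \<Longrightarrow> y \<in> - U \<Longrightarrow> e \<le> dist x y"
  proof -
    have "K \<inter> - U = {}" using KU by auto
    then show ?thesis
      using separate_compact_closed[of K "- U"] KU(1,2) that by (auto simp: closed_Compl)
  qed
  have [measurable]: "A \<in> sets borel" "U - K \<in> sets borel"
    using base KU by (auto intro: borel_compact)
  have fin: "emeasure lborel (U - K) < \<infinity>" using KU(5) by (simp add: order_le_less_trans)
  have I: "integrable lborel (indicat_real (U - K))" using fin by (intro integrable_real_indicator) auto
  have m: "measure lborel (U - K) \<le> d'"
    using KU(5) d' fin by (simp add: measure_def enn2real_leI)
  have "(LINT z|lborel. \<bar>indicator A (z + h) *\<^sub>R c - indicator A z *\<^sub>R c\<bar>) \<le> d" if h: "norm h < e" for h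
  proof -
    have IA: "integrable lborel (\<lambda>z. indicator A z *\<^sub>R c)"
      using base by (auto intro!: integrable_real_indicator)
    have "(LINT z|lborel. \<bar>indicator A (z + h) *\<^sub>R c - indicator A z *\<^sub>R c\<bar>)
      \<le> (LINT z|lborel. \<bar>c\<bar> * (indicator (U - K) z + indicator (U - K) (z + h)))"
    proof (rule integral_mono)
      show "integrable lborel (\<lambda>z. \<bar>indicator A (z + h) *\<^sub>R c - indicator A z *\<^sub>R c\<bar>)"
        using IA integrable_shift[OF IA, of h] by auto
      show "integrable lborel (\<lambda>z. \<bar>c\<bar> * (indicat_real (U - K) z + indicator (U - K) (z + h)))"
        using I integrable_shift[OF I, of h] by auto
      fix z
      have "z + h \<in> K \<Longrightarrow> z \<in> U" "z \<in> K \<Longrightarrow> z + h \<in> U"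
        using e(2)[of "z + h" z] e(2)[of z "z + h"] h by (auto simp: dist_norm)
      then show "\<bar>indicator A (z + h) *\<^sub>R c - indicator A z *\<^sub>R c\<bar>
          \<le> \<bar>c\<bar> * (indicator (U - K) z + indicator (U - K) (z + h))"
        using KU by (auto simp: indicator_def)
    qed
    also have "\<dots> = \<bar>c\<bar> * (2 * measure lborel (U - K))"
      using I integrable_shift[OF I, of h] integral_shift[of "indicat_real (U - K)" h] by simp
    also have "\<dots> \<le> \<bar>c\<bar> * (2 * d')" using m by (intro mult_left_mono) auto
    finally show ?thesis using d' by (simp add: algebra_simps)
  qed
  then show ?case using e by blast
next
  case (add f g)
  obtain e1 where e1: "e1 > 0" "\<And>h. norm h < e1 \<Longrightarrow> (LINT z|lborel. \<bar>f (z + h) - f z\<bar>) \<le> d / 2"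
    using add.IH(1)[of "d / 2"] \<open>d > 0\<close> by auto
  obtain e2 where e2: "e2 > 0" "\<And>h. norm h < e2 \<Longrightarrow> (LINT z|lborel. \<bar>g (z + h) - g z\<bar>) \<le> d / 2"
    using add.IH(2)[of "d / 2"] \<open>d > 0\<close> by auto
  have "(LINT z|lborel. \<bar>f (z + h) + g (z + h) - (f z + g z)\<bar>) \<le> d" if "norm h < min e1 e2" for h
  proof -
    note I = add.hyps integrable_shift[OF add.hyps(1), of h] integrable_shift[OF add.hyps(2), of h]
    have "(LINT z|lborel. \<bar>f (z + h) + g (z + h) - (f z + g z)\<bar>)
      \<le> (LINT z|lborel. \<bar>f (z + h) - f z\<bar> + \<bar>g (z + h) - g z\<bar>)"
      using I by (intro integral_mono integrable_abs Bochner_Integration.integrable_add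
          Bochner_Integration.integrable_diff) auto
    also have "\<dots> = (LINT z|lborel. \<bar>f (z + h) - f z\<bar>) + (LINT z|lborel. \<bar>g (z + h) - g z\<bar>)"
      using I by (intro Bochner_Integration.integral_add) auto
    finally show ?thesis using e1(2)[of h] e2(2)[of h] that by simp
  qed
  then show ?case using e1 e2 by (intro exI[of _ "min e1 e2"]) auto
next
  case (lim f s)
  have [measurable]: "s n \<in> borel_measurable borel" "f \<in> borel_measurable borel" for n
    using lim.hyps(1)[of n] lim.hyps(4) by auto
  have "(\<lambda>n. LINT z|lborel. \<bar>s n z - f z\<bar>) \<longlonglongrightarrow> (LINT z|(lborel :: 'a measure). 0)"
  \<comment> \<open>The approximants satisfy |s n| \<le> 2 |f|, so their distance from f is at most
    3 |f|.\<close>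
  proof (rule integral_dominated_convergence[where w="\<lambda>z. 3 * \<bar>f z\<bar>"])
    show "AE z in lborel. (\<lambda>n. \<bar>s n z - f z\<bar>) \<longlonglongrightarrow> 0"
      using lim.hyps(2) by (auto intro!: tendsto_rabs_zero LIM_zero)
    show "AE z in lborel. norm \<bar>s n z - f z\<bar> \<le> 3 * \<bar>f z\<bar>" for n
    proof (rule AE_I2)
      show "norm \<bar>s n z - f z\<bar> \<le> 3 * \<bar>f z\<bar>" for z
        using lim.hyps(3)[of z n] by simp
    qed
  qed (use lim.hyps(4) in auto)
  then have "\<forall>\<^sub>F n in sequentially. (LINT z|lborel. \<bar>s n z - f z\<bar>) < d / 3"
    using \<open>d > 0\<close> by (intro order_tendstoD) auto
  then obtain n where n: "(LINT z|lborel. \<bar>s n z - f z\<bar>) < d / 3"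
    by (auto simp: eventually_sequentially)
  obtain e where e: "e > 0" "\<And>h. norm h < e \<Longrightarrow> (LINT z|lborel. \<bar>s n (z + h) - s n z\<bar>) \<le> d / 3"
    using lim.IH[of "d / 3"] \<open>d > 0\<close> by auto
  have "(LINT z|lborel. \<bar>f (z + h) - f z\<bar>) \<le> d" if "norm h < e" for h
  proof -
    note I = lim.hyps(1)[of n] lim.hyps(4) integrable_shift[OF lim.hyps(1), of n h] integrable_shift[OF lim.hyps(4), of h]
    have "(LINT z|lborel. \<bar>f (z + h) - f z\<bar>)
      \<le> (LINT z|lborel. \<bar>s n (z + h) - f (z + h)\<bar> + \<bar>s n (z + h) - s n z\<bar> + \<bar>s n z - f z\<bar>)"
      using I by (intro integral_mono integrable_abs Bochner_Integration.integrable_add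
          Bochner_Integration.integrable_diff) auto
    also have "\<dots> = (LINT z|lborel. \<bar>s n (z + h) - f (z + h)\<bar>) + (LINT z|lborel. \<bar>s n (z + h) - s n z\<bar>)
        + (LINT z|lborel. \<bar>s n z - f z\<bar>)"
      using I by simp
    \<comment> \<open>By translation invariance the approximation error is the same before and after
      the shift, hence small for all h at once.\<close>
    also have "(LINT z|lborel. \<bar>s n (z + h) - f (z + h)\<bar>) = (LINT z|lborel. \<bar>s n z - f z\<bar>)"
      using integral_shift[of "\<lambda>z. \<bar>s n z - f z\<bar>" h] by simp
    finally show ?thesis using e(2)[OF that] n by simp
  qed
  then show ?case using e by blast
qed

section \<open>Convolution and approximation by mollifiers\<close>

definition conv :: "('a::euclidean_space \<Rightarrow> real) \<Rightarrow> ('a \<Rightarrow> real) \<Rightarrow> 'a \<Rightarrow> real" where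
  "conv f g z = (LINT w|lborel. f w * g (z - w))"

text \<open>Integrating over z first replaces the shifted g by its full L^1 norm and leaves a
  constant times |f|, which is what Fubini's integrability criterion asks for.\<close>

lemma integrable_conv_pair:
  fixes f g :: "'a::euclidean_space \<Rightarrow> real"
  assumes f: "integrable lborel f" and g: "integrable lborel g"
  shows "integrable (lborel \<Otimes>\<^sub>M lborel) (\<lambda>(w, z). f w * g (z - w))"
proof (rule lborel_pair.Fubini_integrable)
  have [measurable]: "f \<in> borel_measurable borel" "g \<in> borel_measurable borel"
    using f g by auto
  have s: "integrable lborel (\<lambda>z. g (z - w))" for w
    using integrable_shift[OF g, of "- w"] by simp
  show "(\<lambda>(w, z). f w * g (z - w)) \<in> borel_measurable (lborel \<Otimes>\<^sub>M lborel)" by measurable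
  show "AE w in lborel. integrable lborel (\<lambda>z. case (w, z) of (w, z) \<Rightarrow> f w * g (z - w))"
    using s by auto
  have "(LINT z|lborel. norm (case (w, z) of (w, z) \<Rightarrow> f w * g (z - w))) = \<bar>f w\<bar> * (LINT z|lborel. \<bar>g z\<bar>)" for w
    using integral_shift[of "\<lambda>z. \<bar>g z\<bar>" "- w"] s[of w] by (simp add: abs_mult)
  then show "integrable lborel (\<lambda>w. LINT z|lborel. norm (case (w, z) of (w, z) \<Rightarrow> f w * g (z - w)))"
    using f by simp
qed

lemma integrable_conv:
  fixes f g :: "'a::euclidean_space \<Rightarrow> real"
  assumes "integrable lborel f" "integrable lborel g"
  shows "integrable lborel (conv f g)"
  using lborel_pair.integrable_fst'[OF lborel_pair.integrable_product_swap[OF integrable_conv_pair[OF assms]]]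
  by (simp add: conv_def[abs_def])

lemma conv_commute:
  fixes f g :: "'a::euclidean_space \<Rightarrow> real"
  assumes [measurable]: "f \<in> borel_measurable borel" "g \<in> borel_measurable borel"
  shows "conv f g z = (LINT w|lborel. f (z - w) * g w)"
  using integral_reflect[of "\<lambda>w. f w * g (z - w)" z] by (simp add: conv_def)

lemma integrable_mult_bounded:
  fixes f :: "'a::euclidean_space \<Rightarrow> real"
  assumes f: "integrable lborel f" and g: "g \<in> borel_measurable borel" "\<And>w. \<bar>g w\<bar> \<le> B"
  shows "integrable lborel (\<lambda>w. f w * g w)"
proof (rule Bochner_Integration.integrable_bound[OF integrable_mult_left[OF f, of B]])
  show "AE w in lborel. norm (f w * g w) \<le> norm (f w * B)"
    using g(2) by (auto simp: abs_mult intro!: AE_I2 mult_left_mono order_trans[OF g(2)])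
qed (use f g in auto)

text \<open>The number e only bounds how far the support reaches from the origin; the kernel may be
  off centre. This freedom allows it to sit on one side of the boundary.\<close>

definition mollifier :: "real \<Rightarrow> ('a::euclidean_space \<Rightarrow> real) \<Rightarrow> bool" where
  "mollifier e \<rho> \<longleftrightarrow> test_fun UNIV \<rho> \<and> (\<forall>z. \<rho> z \<ge> 0) \<and> (LINT z|lborel. \<rho> z) = 1 \<and>
     (\<forall>z. norm z \<ge> e \<longrightarrow> \<rho> z = 0)"

text \<open>The kernel has mass 1, so \<open>conv f \<rho> z - f z\<close> is the \<rho>-average of
  f(z - w) - f(z), and by Tonelli its L^1 norm is at most the average of the translation errors over
  |w| < e. The threshold e depends on f and d alone, so the shape and position of the kernel stay
  free.\<close>

lemma mollifier_approx:
  fixes f :: "'a::euclidean_space \<Rightarrow> real"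
  assumes f: "integrable lborel f" and d: "d > 0"
  shows "\<exists>e>0. \<forall>\<rho>. mollifier e \<rho> \<longrightarrow> (LINT z|lborel. \<bar>conv f \<rho> z - f z\<bar>) \<le> d"
proof -
  obtain e where e: "e > 0" "\<And>h. norm h < e \<Longrightarrow> (LINT z|lborel. \<bar>f (z + h) - f z\<bar>) \<le> d"
    using L1_translation_continuous[OF f d] by blast
  have "(LINT z|lborel. \<bar>conv f \<rho> z - f z\<bar>) \<le> d" if \<rho>: "mollifier e \<rho>" for \<rho>
  proof -
    have I\<rho>: "integrable lborel \<rho>" using \<rho> test_fun_integrable mollifier_def by blast
    have [measurable]: "f \<in> borel_measurable borel" "\<rho> \<in> borel_measurable borel"
      using f I\<rho> by auto
    have nonneg: "\<rho> w \<ge> 0" for w using \<rho> by (simp add: mollifier_def)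
    have nn\<rho>: "(\<integral>\<^sup>+w. ennreal (\<rho> w) \<partial>lborel) = 1"
      using nn_integral_eq_integral[OF I\<rho>] nonneg \<rho> by (simp add: mollifier_def)
    have Ic: "integrable lborel (\<lambda>z. \<bar>conv f \<rho> z - f z\<bar>)"
      using integrable_conv[OF f I\<rho>] f by simp
    have pointwise: "ennreal \<bar>conv f \<rho> z - f z\<bar> \<le> (\<integral>\<^sup>+w. ennreal (\<bar>f (z - w) - f z\<bar> * \<rho> w) \<partial>lborel)" for z
    proof -
      obtain B where B: "\<And>w. \<bar>\<rho> w\<bar> \<le> B" using \<rho> test_fun_bounded mollifier_def by metis
      have s: "integrable lborel (\<lambda>w. f (z - w))"
        using integrable_distr_eq[of "\<lambda>w. z - w" lborel borel f] f
        by (simp add: measure_preserving_reflect)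
      have I1: "integrable lborel (\<lambda>w. f (z - w) * \<rho> w)"
        by (rule integrable_mult_bounded[OF s _ B]) measurable
      have "conv f \<rho> z - f z = (LINT w|lborel. f (z - w) * \<rho> w - f z * \<rho> w)"
        using I1 I\<rho> \<rho> by (simp add: conv_commute mollifier_def)
      also have "ennreal (norm \<dots>) \<le> (\<integral>\<^sup>+w. ennreal (norm (f (z - w) * \<rho> w - f z * \<rho> w)) \<partial>lborel)"
        using I1 I\<rho> by (intro integral_norm_bound_ennreal) auto
      also have "\<dots> = (\<integral>\<^sup>+w. ennreal (\<bar>f (z - w) - f z\<bar> * \<rho> w) \<partial>lborel)"
        using nonneg by (intro nn_integral_cong) (simp add: left_diff_distrib[symmetric] abs_mult)
      finally show ?thesis by simp
    qed
    have "ennreal (LINT z|lborel. \<bar>conv f \<rho> z - f z\<bar>) = (\<integral>\<^sup>+z. ennreal \<bar>conv f \<rho> z - f z\<bar> \<partial>lborel)"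
      using Ic by (intro nn_integral_eq_integral[symmetric]) auto
    also have "\<dots> \<le> (\<integral>\<^sup>+z. \<integral>\<^sup>+w. ennreal (\<bar>f (z - w) - f z\<bar> * \<rho> w) \<partial>lborel \<partial>lborel)"
      by (intro nn_integral_mono pointwise)
    also have "\<dots> = (\<integral>\<^sup>+w. \<integral>\<^sup>+z. ennreal (\<bar>f (z - w) - f z\<bar> * \<rho> w) \<partial>lborel \<partial>lborel)"
      by (intro lborel_pair.Fubini') measurable
    also have "\<dots> \<le> (\<integral>\<^sup>+w. ennreal d * ennreal (\<rho> w) \<partial>lborel)"
    proof (rule nn_integral_mono)
      fix w
      show "(\<integral>\<^sup>+z. ennreal (\<bar>f (z - w) - f z\<bar> * \<rho> w) \<partial>lborel) \<le> ennreal d * ennreal (\<rho> w)"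
      proof (cases "norm w < e")
        case True
        have "(\<integral>\<^sup>+z. ennreal (\<bar>f (z - w) - f z\<bar> * \<rho> w) \<partial>lborel)
            = (\<integral>\<^sup>+z. ennreal \<bar>f (z - w) - f z\<bar> \<partial>lborel) * ennreal (\<rho> w)"
          using nonneg by (simp add: ennreal_mult nn_integral_multc)
        also have "(\<integral>\<^sup>+z. ennreal \<bar>f (z - w) - f z\<bar> \<partial>lborel) = ennreal (LINT z|lborel. \<bar>f (z - w) - f z\<bar>)"
          using integrable_shift[OF f, of "- w"] f by (intro nn_integral_eq_integral) auto
        also have "\<dots> \<le> ennreal d" using e(2)[of "- w"] True by (simp add: ennreal_leI)
        finally show ?thesis by (simp add: mult_right_mono)
      next
        case False
        then show ?thesis using \<rho> by (simp add: mollifier_def)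
      qed
    qed
    also have "\<dots> = ennreal d" using nn\<rho> by (simp add: nn_integral_cmult)
    finally show ?thesis using d by (simp add: ennreal_le_iff)
  qed
  then show ?thesis using e(1) by blast
qed

text \<open>All dependence on z sits in the kernel: the remainder quotients of \<rho> tend to 0
  pointwise and are bounded by 2 B, one B for the increment and one for the linear term, so
  dominated convergence with 2 B |f| differentiates under the integral.\<close>

lemma conv_has_derivative:
  fixes f :: "'a::euclidean_space \<Rightarrow> real"
  assumes f: "integrable lborel f" and \<rho>: "test_fun UNIV \<rho>"
  shows "(conv f \<rho> has_derivative (\<lambda>h. LINT w|lborel. f w * pd h \<rho> (z - w))) (at z)"
proof -
  obtain B where B: "B > 0" "\<And>h z. \<bar>pd h \<rho> z\<bar> \<le> B * norm h" "\<And>x y. \<bar>\<rho> x - \<rho> y\<bar> \<le> B * norm (x - y)"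
    using test_fun_derivative_bound[OF \<rho>] by metis
  obtain C where C: "\<And>w. \<bar>\<rho> w\<bar> \<le> C" using test_fun_bounded[OF \<rho>] by metis
  note D = pd_has_derivative[OF smooth_differentiable[OF test_fun_smooth[OF \<rho>]]]
  have [measurable]: "f \<in> borel_measurable borel" "\<rho> \<in> borel_measurable borel"
    using f test_fun_integrable[OF \<rho>] by auto
  have [measurable]: "(\<lambda>z. pd h \<rho> z) \<in> borel_measurable borel" for h
  proof -
    have "(\<lambda>z. pd h \<rho> z) = (\<lambda>z. \<Sum>j\<in>Basis. (h \<bullet> j) * pd j \<rho> z)"
      using pd_basis_sum[OF smooth_differentiable[OF test_fun_smooth[OF \<rho>]]] by blast
    then show ?thesis
      using test_fun_smooth[OF \<rho>]
      by (auto intro!: smooth_measurable smooth_sum smooth_mult smooth_pd)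
  qed
  have I: "integrable lborel (\<lambda>w. f w * pd h \<rho> (z - w))" for h
    by (rule integrable_mult_bounded[OF f _ B(2)]) measurable
  have I2: "integrable lborel (\<lambda>w. f w * \<rho> (y - w))" for y
    by (rule integrable_mult_bounded[OF f _ C]) measurable
  define L where "L h = (LINT w|lborel. f w * pd h \<rho> (z - w))" for h
  have "bounded_linear L"
  proof (rule bounded_linear_intro[where K="B * (LINT w|lborel. \<bar>f w\<bar>)"])
    show "L (x + y) = L x + L y" for x y
      using I linear_add[OF has_derivative_linear[OF D]]
      by (simp add: L_def distrib_left)
    show "L (r *\<^sub>R x) = r *\<^sub>R L x" for r x
      using linear_scale[OF has_derivative_linear[OF D]]
      by (simp add: L_def mult.left_commute[of _ r])
    show "norm (L x) \<le> norm x * (B * (LINT w|lborel. \<bar>f w\<bar>))" for x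
    proof -
      have "norm (L x) \<le> (LINT w|lborel. norm (f w * pd x \<rho> (z - w)))"
        unfolding L_def by (rule integral_norm_bound)
      also have "\<dots> \<le> (LINT w|lborel. \<bar>f w\<bar> * (B * norm x))"
        using integrable_norm[OF I[of x]] f B(2)
        by (intro integral_mono) (auto simp: abs_mult intro!: mult_left_mono)
      finally show ?thesis by (simp add: algebra_simps)
    qed
  qed
  moreover have "((\<lambda>h. norm (conv f \<rho> (z + h) - conv f \<rho> z - L h) / norm h) \<longlongrightarrow> 0) (at 0)"
    \<comment> \<open>Dominated convergence speaks of sequences, so the limit at 0 is tested along
      arbitrary sequences of nonzero increments.\<close>
    unfolding tendsto_at_iff_sequentially
  proof (intro allI impI)
    fix h :: "nat \<Rightarrow> 'a"
    assume "\<forall>i. h i \<in> UNIV - {0}" and h0: "h \<longlonglongrightarrow> 0"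
    then have h: "h n \<noteq> 0" for n by auto
    define Q where "Q n w = f w * ((\<rho> (z + h n - w) - \<rho> (z - w) - pd (h n) \<rho> (z - w)) / norm (h n))" for n w
    have "(\<lambda>n. LINT w|lborel. Q n w) \<longlonglongrightarrow> (LINT w|(lborel::'a measure). 0)"
    proof (rule integral_dominated_convergence[where w="\<lambda>w. \<bar>f w\<bar> * (2 * B)"])
      show "AE w in lborel. (\<lambda>n. Q n w) \<longlonglongrightarrow> 0"
      proof (rule AE_I2)
        fix w
        have "((\<lambda>h. norm (\<rho> ((z - w) + h) - \<rho> (z - w) - pd h \<rho> (z - w)) / norm h) \<longlongrightarrow> 0) (at 0)"
          using D[of "z - w"] by (simp add: has_derivative_at)
        moreover have "filterlim h (at 0) sequentially"
          using h h0 by (intro filterlim_atI) auto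
        ultimately have "(\<lambda>n. norm (\<rho> ((z - w) + h n) - \<rho> (z - w) - pd (h n) \<rho> (z - w)) / norm (h n)) \<longlonglongrightarrow> 0"
          by (rule filterlim_compose)
        then have "(\<lambda>n. \<bar>f w\<bar> * (norm (\<rho> ((z - w) + h n) - \<rho> (z - w) - pd (h n) \<rho> (z - w)) / norm (h n))) \<longlonglongrightarrow> 0"
          by (rule tendsto_mult_right_zero)
        then show "(\<lambda>n. Q n w) \<longlonglongrightarrow> 0"
          by (intro tendsto_rabs_zero_cancel[of "\<lambda>n. Q n w"]) (simp add: Q_def abs_mult diff_add_eq)
      qed
      show "AE w in lborel. norm (Q n w) \<le> \<bar>f w\<bar> * (2 * B)" for n
      proof (rule AE_I2)
        fix w
        have "\<bar>\<rho> (z + h n - w) - \<rho> (z - w) - pd (h n) \<rho> (z - w)\<bar> \<le> 2 * B * norm (h n)"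
          using B(2)[of "z - w" "h n"] B(3)[of "z + h n - w" "z - w"] by simp
        then show "norm (Q n w) \<le> \<bar>f w\<bar> * (2 * B)"
          using h[of n] unfolding Q_def real_norm_def abs_mult abs_divide
          by (intro mult_left_mono) (auto simp: divide_simps)
      qed
    qed (use f in \<open>auto simp: Q_def\<close>)
    moreover have "(LINT w|lborel. Q n w) = (conv f \<rho> (z + h n) - conv f \<rho> z - L (h n)) / norm (h n)" for n
    proof -
      have "(LINT w|lborel. Q n w) =
          (LINT w|lborel. (f w * \<rho> (z + h n - w) - f w * \<rho> (z - w) - f w * pd (h n) \<rho> (z - w)) / norm (h n))"
        by (simp add: Q_def right_diff_distrib)
      then show ?thesis
        using I I2 by (simp add: conv_def L_def)
    qed
    ultimately have "(\<lambda>n. (conv f \<rho> (z + h n) - conv f \<rho> z - L (h n)) / norm (h n)) \<longlonglongrightarrow> 0"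
      by simp
    from tendsto_rabs_zero[OF this]
    show "((\<lambda>h. norm (conv f \<rho> (z + h) - conv f \<rho> z - L h) / norm h) \<circ> h) \<longlonglongrightarrow> 0"
      by (simp add: o_def abs_divide)
  qed
  ultimately have "(conv f \<rho> has_derivative L) (at z)" by (simp add: has_derivative_at)
  then show ?thesis by (simp add: L_def[abs_def])
qed

lemma pd_conv:
  assumes "integrable lborel f" "test_fun UNIV \<rho>"
  shows "pd i (conv f \<rho>) z = conv f (pd i \<rho>) z"
  using pd_eq[OF conv_has_derivative[OF assms]] by (auto simp: conv_def)

text \<open>Each derivative moves onto \<rho>, and partials of \<rho> are test functions again;
  hence the induction with \<rho> arbitrary.\<close>

lemma smooth_conv:
  assumes f: "integrable lborel f" and "test_fun UNIV \<rho>"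
  shows "smooth (conv f \<rho>)"
proof -
  have "Ck k (conv f \<rho>)" for k
    using assms(2)
  proof (induction k arbitrary: \<rho>)
    case 0
    have "conv f \<rho> differentiable (at z)" for z
      using conv_has_derivative[OF f 0] by (rule differentiableI)
    then show ?case
      by (auto intro!: continuous_at_imp_continuous_on differentiable_imp_continuous_within)
  next
    case (Suc k)
    have "conv f \<rho> differentiable (at z)" for z
      using conv_has_derivative[OF f Suc.prems] by (rule differentiableI)
    then show ?case
      using Suc.IH[OF test_fun_pd[OF Suc.prems]] pd_conv[OF f Suc.prems] by simp
  qed
  then show ?thesis by (simp add: smooth_def)
qed

section \<open>Approximation of weak derivatives on the half-space\<close>

lemma AE_notin_open:
  fixes S :: "'a::euclidean_space set"
  assumes "open S" "AE z in lborel. z \<notin> S"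
  shows "S = {}"
proof -
  have "AE z in lebesgue. z \<notin> S" using assms(2) by (rule AE_completion)
  then have "S \<in> null_sets lebesgue"
    using AE_iff_null_sets[of S lebesgue] assms(1) by simp
  then have "negligible S" by (simp add: negligible_iff_null_sets)
  then show ?thesis using open_not_negligible assms(1) by blast
qed

text \<open>The kernel is a bump moved to the ball of radius r about a and divided by its integral,
  which is positive since a nonempty open ball is not a null set.\<close>

lemma ex_mollifier:
  fixes a :: "'a::euclidean_space"
  assumes r: "r > 0" and sub: "cball a r \<subseteq> ball 0 e" "cball a r \<subseteq> \<Omega>"
  obtains \<rho> where "mollifier e \<rho>" "test_fun \<Omega> \<rho>"
proof -
  define \<beta> where "\<beta> z = bump (- (a /\<^sub>R r) + z /\<^sub>R r)" for z
  have \<beta>: "\<beta> z = bump ((z - a) /\<^sub>R r)" for z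
    by (simp add: \<beta>_def scaleR_diff_right)
  have "bounded_linear (\<lambda>z::'a. z /\<^sub>R r)" by (rule bounded_linear_scaleR_right)
  then have sm: "smooth \<beta>"
    using smooth_affine[OF _ smooth_bump, of "\<lambda>z. z /\<^sub>R r" "- (a /\<^sub>R r)"] by (simp add: \<beta>_def[abs_def])
  have n: "norm ((z - a) /\<^sub>R r) = dist a z / r" for z
    unfolding norm_scaleR using r by (simp add: dist_norm norm_minus_commute divide_inverse mult.commute)
  have z0: "\<beta> z = 0" if "z \<notin> ball a r" for z
    unfolding \<beta> using that r by (intro bump_eq_0) (simp add: n del: scaleR_right_diff_distrib norm_scaleR)
  have pos: "\<beta> z > 0" if "z \<in> ball a r" for z
    unfolding \<beta> using that r by (intro bump_pos) (simp add: n del: scaleR_right_diff_distrib norm_scaleR)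
  have nn: "\<beta> z \<ge> 0" for z by (simp add: \<beta> bump_nonneg)
  have T: "test_fun \<Omega> \<beta>"
    using sub by (intro test_funI[OF sm compact_cball[of a r]] z0) auto
  have "(LINT z|lborel. \<beta> z) \<noteq> 0"
  proof
    assume "(LINT z|lborel. \<beta> z) = 0"
    then have "AE z in lborel. \<beta> z = 0"
      using integral_nonneg_eq_0_iff_AE[OF test_fun_integrable[OF T]] nn by simp
    then have "AE z in lborel. z \<notin> ball a r"
      by (rule eventually_mono) (use pos in force)
    then show False using AE_notin_open[of "ball a r"] r by simp
  qed
  then have I: "(LINT z|lborel. \<beta> z) > 0"
    using nn by (simp add: less_le)
  define \<rho> where "\<rho> z = inverse (LINT z|lborel. \<beta> z) * \<beta> z" for z
  have T\<rho>: "test_fun \<Omega> \<rho>"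
    unfolding \<rho>_def by (rule test_fun_mult[OF T smooth_const])
  moreover have "\<rho> z = 0" if "norm z \<ge> e" for z
  proof -
    have "z \<in> ball 0 e" if "z \<in> ball a r" using that sub(1) ball_subset_cball by blast
    then have "z \<notin> ball a r" using that by auto
    then show ?thesis using z0 by (simp add: \<rho>_def)
  qed
  ultimately have "mollifier e \<rho>"
    using nn I test_fun_mono[OF T\<rho>] by (auto simp: mollifier_def \<rho>_def)
  with T\<rho> show ?thesis using that by blast
qed

lemma mollifier_mono: "mollifier e \<rho> \<Longrightarrow> e \<le> e' \<Longrightarrow> mollifier e' \<rho>"
  by (auto simp: mollifier_def)

text \<open>A function and all its weak partials have to be approximated by one and the same kernel;
  the minimum of finitely many thresholds provides it.\<close>

lemma mollifier_approx_finite: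
  assumes "finite F" "\<And>f. f \<in> F \<Longrightarrow> integrable lborel f" "d > 0"
  shows "\<exists>e>0. \<forall>\<rho>. mollifier e \<rho> \<longrightarrow> (\<forall>f\<in>F. (LINT z|lborel. \<bar>conv f \<rho> z - f z\<bar>) \<le> d)"
  using assms(1,2)
proof (induction F rule: finite_induct)
  case empty
  then show ?case by (auto intro: exI[of _ 1])
next
  case (insert f F)
  obtain e where e: "e > 0" "\<And>\<rho>. mollifier e \<rho> \<Longrightarrow> \<forall>f\<in>F. (LINT z|lborel. \<bar>conv f \<rho> z - f z\<bar>) \<le> d"
    using insert by blast
  obtain e' where e': "e' > 0" "\<And>\<rho>. mollifier e' \<rho> \<Longrightarrow> (LINT z|lborel. \<bar>conv f \<rho> z - f z\<bar>) \<le> d"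
    using mollifier_approx[of f d] insert.prems \<open>d > 0\<close> by blast
  show ?case
  proof (intro exI[of _ "min e e'"] conjI allI impI)
    show "min e e' > 0" using e(1) e'(1) by simp
    fix \<rho> :: "'a \<Rightarrow> real" assume "mollifier (min e e') \<rho>"
    then have "mollifier e \<rho>" "mollifier e' \<rho>" by (auto intro: mollifier_mono)
    then show "\<forall>f\<in>insert f F. (LINT z|lborel. \<bar>conv f \<rho> z - f z\<bar>) \<le> d"
      using e(2) e'(2) by blast
  qed
qed

abbreviation lower_half_space :: "('a::euclidean_space \<times> real) set" where
  "lower_half_space \<equiv> {z. snd z < 0}"

lemma ex_mollifier_lower:
  assumes "e > 0"
  obtains \<rho> :: "'a::euclidean_space \<times> real \<Rightarrow> real"
  where "mollifier e \<rho>" "test_fun lower_half_space \<rho>"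
proof (rule ex_mollifier)
  \<comment> \<open>Depth e / 2 with radius e / 4 keeps the support at least e / 4 below the
    boundary and within 3 e / 4 of the origin.\<close>
  define a :: "'a \<times> real" where "a = (0, - (e / 2))"
  have na: "norm a = e / 2" using assms by (simp add: a_def norm_Pair)
  show "e / 4 > 0" using assms by simp
  show "cball a (e / 4) \<subseteq> ball 0 e"
  proof
    fix z assume "z \<in> cball a (e / 4)"
    then have "norm (z - a) \<le> e / 4" by (simp add: dist_norm norm_minus_commute)
    then show "z \<in> ball 0 e" using norm_triangle_sub[of z a] na assms by simp
  qed
  show "cball a (e / 4) \<subseteq> lower_half_space"
  proof
    fix z assume "z \<in> cball a (e / 4)"
    then have "dist (snd a) (snd z) \<le> e / 4" using dist_snd_le[of a z] by simp
    then have "\<bar>- (e / 2) - snd z\<bar> \<le> e / 4" by (simp add: a_def dist_real_def)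
    then have "snd z < 0" using assms by linarith
    then show "z \<in> lower_half_space" by simp
  qed
qed (use that in blast)

lemma open_half_space: "open half_space"
proof -
  have "half_space = {z::'a \<times> real. 0 < snd z}" by (auto simp: half_space_def)
  then show ?thesis using open_Collect_less[of "\<lambda>_. 0" "snd :: 'a \<times> real \<Rightarrow> real"]
    by (simp add: continuous_on_snd)
qed

lemma half_space_borel [measurable, simp]: "half_space \<in> sets borel"
  by (rule borel_open[OF open_half_space])

text \<open>Subtracting a compact set below the boundary from a point above it gives a compact set
  above it, and this set contains the support in w.\<close>

lemma test_fun_reflect:
  fixes \<rho> :: "'a::euclidean_space \<times> real \<Rightarrow> real"
  assumes \<rho>: "test_fun lower_half_space \<rho>" and z: "z \<in> half_space"
  shows "test_fun half_space (\<lambda>w. \<rho> (z - w))"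
proof -
  obtain K where K: "compact K" "K \<subseteq> lower_half_space" "\<And>w. w \<notin> K \<Longrightarrow> \<rho> w = 0"
    using \<rho> unfolding test_fun_def by blast
  have "smooth (\<lambda>w. \<rho> (z + - w))"
    by (rule smooth_affine[OF bounded_linear_minus[OF bounded_linear_ident] test_fun_smooth[OF \<rho>]])
  then have sm: "smooth (\<lambda>w. \<rho> (z - w))" by simp
  show ?thesis
  proof (rule test_funI[OF sm])
    show "compact ((\<lambda>k. z - k) ` K)"
      by (intro compact_continuous_image continuous_intros K)
    show "(\<lambda>k. z - k) ` K \<subseteq> half_space"
      using K(2) z by (force simp: half_space_def)
    show "\<rho> (z - w) = 0" if "w \<notin> (\<lambda>k. z - k) ` K" for w
    proof (rule K(3), rule notI)
      assume "z - w \<in> K"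
      then have "w \<in> (\<lambda>k. z - k) ` K" by (intro image_eqI[of _ _ "z - w"]) auto
      then show False using that by simp
    qed
  qed
qed

lemma pd_reflect:
  assumes "smooth \<rho>"
  shows "pd i (\<lambda>w. \<rho> (z - w)) w = - pd i \<rho> (z - w)"
proof -
  have D: "(\<rho> has_derivative (\<lambda>h. pd h \<rho> (z - w))) (at (z - w))"
    by (rule pd_has_derivative[OF smooth_differentiable[OF assms]])
  have "((\<lambda>w. \<rho> (z - w)) has_derivative (\<lambda>h. pd (- h) \<rho> (z - w))) (at w)"
    by (rule has_derivative_compose[where f="\<lambda>w. z - w", OF _ D])
       (auto intro!: derivative_eq_intros)
  then have "pd i (\<lambda>w. \<rho> (z - w)) w = pd (- i) \<rho> (z - w)" by (rule pd_eq)
  then show ?thesis using linear_neg[OF has_derivative_linear[OF D]] by simp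
qed

text \<open>One component of \<open>has_weak_grad\<close> on the half-space, restated with Borel
  measure and integrals over the whole space. Test functions vanish off the half-space, so there u
  and g are tied by integrability alone.\<close>

definition weak_pd :: "'a::euclidean_space \<times> real \<Rightarrow> ('a \<times> real \<Rightarrow> real) \<Rightarrow> ('a \<times> real \<Rightarrow> real) \<Rightarrow> bool" where
  "weak_pd i u g \<longleftrightarrow> integrable lborel u \<and> integrable lborel g \<and>
     (\<forall>\<phi>. test_fun half_space \<phi> \<longrightarrow>
        (LINT z|lborel. u z * pd i \<phi> z) = - (LINT z|lborel. g z * \<phi> z))"

lemma test_fun_mult_integrable:
  fixes f :: "'a::euclidean_space \<Rightarrow> real"
  assumes "integrable lborel f" "test_fun \<Omega> \<phi>"
  shows "integrable lborel (\<lambda>z. f z * \<phi> z)"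
proof -
  obtain B where "\<And>w. \<bar>\<phi> w\<bar> \<le> B" using test_fun_bounded[OF assms(2)] by metis
  then show ?thesis
    using assms test_fun_smooth by (intro integrable_mult_bounded smooth_measurable) auto
qed

lemma weak_pd_diff:
  assumes "weak_pd i u g" "weak_pd i v h" "i \<in> Basis"
  shows "weak_pd i (\<lambda>z. u z - v z) (\<lambda>z. g z - h z)"
  using assms unfolding weak_pd_def
  by (auto simp: left_diff_distrib test_fun_mult_integrable test_fun_mult_integrable[OF _ test_fun_pd])

text \<open>For a mollifier supported in the lower half-space, the convolution at a point of the
  half-space pairs with a test function of the half-space: no extension of \<open>u\<close> across the
  boundary is needed.\<close>

lemma pd_conv_weak:
  assumes w: "weak_pd i u g" and i: "i \<in> Basis" and z: "z \<in> half_space"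
    and \<rho>: "test_fun lower_half_space \<rho>"
  shows "pd i (conv u \<rho>) z = conv g \<rho> z"
proof -
  have "pd i (conv u \<rho>) z = conv u (pd i \<rho>) z"
    using w test_fun_mono[OF \<rho>, of UNIV] by (simp add: pd_conv weak_pd_def)
  also have "\<dots> = - (LINT w|lborel. u w * pd i (\<lambda>w. \<rho> (z - w)) w)"
    by (simp add: conv_def pd_reflect[OF test_fun_smooth[OF \<rho>]])
  also have "\<dots> = conv g \<rho> z"
    using w test_fun_reflect[OF \<rho> z] by (simp add: weak_pd_def conv_def)
  finally show ?thesis .
qed

lemma set_integral_le_integral:
  fixes f :: "'a::euclidean_space \<Rightarrow> real"
  assumes "integrable lborel f" "S \<in> sets borel"
  shows "(LINT z:S|lborel. \<bar>f z\<bar>) \<le> (LINT z|lborel. \<bar>f z\<bar>)"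
  unfolding set_lebesgue_integral_def
  using assms integrable_mult_indicator[of S lborel "\<lambda>z. \<bar>f z\<bar>"]
  by (intro integral_mono) (auto simp: indicator_def)

text \<open>The difference f of two weak derivatives is a weak derivative of 0. Its mollifications
  by kernels below the boundary are therefore, on the half-space, partials of 0; they also
  approximate f in L^1.\<close>

lemma weak_pd_unique:
  fixes u g h :: "'a::euclidean_space \<times> real \<Rightarrow> real"
  assumes "weak_pd i u g" "weak_pd i u h" and i: "i \<in> Basis"
  shows "AE z in lborel. z \<in> half_space \<longrightarrow> g z = h z"
proof -
  define f where "f z = g z - h z" for z
  have w: "weak_pd i (\<lambda>z. 0) f"
    using weak_pd_diff[OF assms] by (simp add: f_def[abs_def])
  then have If: "integrable lborel f" by (simp add: weak_pd_def)
  have IH: "integrable lborel (\<lambda>z. indicator half_space z *\<^sub>R \<bar>f z\<bar>)"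
    using If by (intro integrable_mult_indicator) auto
  have "(LINT z:half_space|lborel. \<bar>f z\<bar>) \<le> d" if "d > 0" for d
  proof -
    obtain e where e: "e > 0" "\<And>\<rho>. mollifier e \<rho> \<Longrightarrow> (LINT z|lborel. \<bar>conv f \<rho> z - f z\<bar>) \<le> d"
      using mollifier_approx[OF If \<open>d > 0\<close>] by blast
    obtain \<rho> :: "'a \<times> real \<Rightarrow> real" where \<rho>: "mollifier e \<rho>" "test_fun lower_half_space \<rho>"
      using ex_mollifier_lower[OF e(1)] .
    have "conv f \<rho> z = 0" if "z \<in> half_space" for z
      using pd_conv_weak[OF w i that \<rho>(2)] by (simp add: conv_def[abs_def])
    then have "(LINT z:half_space|lborel. \<bar>f z\<bar>) = (LINT z:half_space|lborel. \<bar>conv f \<rho> z - f z\<bar>)"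
      unfolding set_lebesgue_integral_def
      by (intro Bochner_Integration.integral_cong) (auto simp: indicator_def)
    also have "\<dots> \<le> (LINT z|lborel. \<bar>conv f \<rho> z - f z\<bar>)"
      using If test_fun_integrable[OF \<rho>(2)]
      by (intro set_integral_le_integral Bochner_Integration.integrable_diff integrable_conv) auto
    also have "\<dots> \<le> d" by (rule e(2)[OF \<rho>(1)])
    finally show ?thesis .
  qed
  then have "(LINT z:half_space|lborel. \<bar>f z\<bar>) \<le> 0"
    by (meson dense not_le)
  then have "(LINT z|lborel. indicator half_space z *\<^sub>R \<bar>f z\<bar>) = 0"
    by (intro antisym Bochner_Integration.integral_nonneg) (auto simp: set_lebesgue_integral_def)
  then have "AE z in lborel. indicator half_space z *\<^sub>R \<bar>f z\<bar> = 0"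
    using integral_nonneg_eq_0_iff_AE[OF IH] by simp
  then show ?thesis by (auto simp: f_def elim!: eventually_mono)
qed

text \<open>Multiply v by cut-offs \<zeta>(s z) with s tending to 0. The term that differentiates
  the cut-off carries the factor s and is dominated by a multiple of |v|; in the other term the
  cut-off tends to 1.\<close>

lemma smooth_cutoff:
  fixes v :: "'a::euclidean_space \<Rightarrow> real"
  assumes v: "smooth v" "integrable lborel v" "\<And>i. i \<in> Basis \<Longrightarrow> integrable lborel (pd i v)"
    and d: "d > 0"
  obtains w where "test_fun UNIV w" "(LINT z|lborel. \<bar>w z - v z\<bar>) \<le> d"
    "\<And>i. i \<in> Basis \<Longrightarrow> (LINT z|lborel. \<bar>pd i w z - pd i v z\<bar>) \<le> d"
proof -
  \<comment> \<open>Dividing by the maximal value \<open>bump 0\<close> gives values in [0, 1] and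
    the value 1 at the origin, so that the dilations tend to 1 at every point.\<close>
  define \<zeta> :: "'a \<Rightarrow> real" where "\<zeta> z = inverse (bump (0::'a)) * bump z" for z
  have T: "test_fun UNIV \<zeta>" unfolding \<zeta>_def by (rule test_fun_mult[OF test_fun_bump smooth_const])
  note S = test_fun_smooth[OF T]
  have \<zeta>: "0 \<le> \<zeta> z" "\<zeta> z \<le> 1" for z
    using bump_pos[of "0::'a"] bump_nonneg[of z] bump_antimono[of 0 z] by (auto simp: \<zeta>_def field_simps)
  have \<zeta>0: "\<zeta> 0 = 1" using bump_pos[of "0::'a"] by (simp add: \<zeta>_def)
  define s where "s n = inverse (real (Suc n))" for n
  have s: "s n > 0" "s n \<le> 1" "s \<longlonglongrightarrow> 0" for n
    using LIMSEQ_inverse_real_of_nat by (auto simp: s_def[abs_def] field_simps)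
  define \<zeta>n where "\<zeta>n n z = \<zeta> (0 + s n *\<^sub>R z)" for n z
  have Sn: "smooth (\<zeta>n n)" for n
    unfolding \<zeta>n_def by (rule smooth_affine[OF bounded_linear_scaleR_right S])
  have "\<zeta>n n z = 0" if "z \<notin> cball 0 (inverse (s n))" for n z
    using that s(1)[of n] by (auto simp: \<zeta>n_def \<zeta>_def field_simps intro!: bump_eq_0)
  then have Tn: "test_fun UNIV (\<zeta>n n)" for n
    by (intro test_funI[OF Sn compact_cball[of 0 "inverse (s n)"]]) auto
  have pdn: "pd i (\<zeta>n n) z = s n * pd i \<zeta> (s n *\<^sub>R z)" for n z i
  proof -
    have D: "(\<zeta> has_derivative (\<lambda>h. pd h \<zeta> (s n *\<^sub>R z))) (at (s n *\<^sub>R z))"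
      by (rule pd_has_derivative[OF smooth_differentiable[OF S]])
    have "((\<lambda>z. \<zeta> (s n *\<^sub>R z)) has_derivative (\<lambda>h. pd (s n *\<^sub>R h) \<zeta> (s n *\<^sub>R z))) (at z)"
      by (rule has_derivative_compose[where f="\<lambda>z. s n *\<^sub>R z", OF _ D])
         (auto intro!: derivative_eq_intros)
    then have "pd i (\<zeta>n n) z = pd (s n *\<^sub>R i) \<zeta> (s n *\<^sub>R z)" unfolding \<zeta>n_def by (intro pd_eq) simp
    then show ?thesis using linear_scale[OF has_derivative_linear[OF D]] by simp
  qed
  define w where "w n z = v z * \<zeta>n n z" for n z
  have Tw: "test_fun UNIV (w n)" for n unfolding w_def by (rule test_fun_mult[OF Tn v(1)])
  have pdw: "pd i (w n) z = v z * pd i (\<zeta>n n) z + pd i v z * \<zeta>n n z" for i n z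
    unfolding w_def by (intro pd_mult smooth_differentiable v Sn)
  have lim: "(\<lambda>n. \<zeta>n n z) \<longlonglongrightarrow> 1" for z
  proof -
    have "(\<lambda>n. \<zeta> (0 + s n *\<^sub>R z)) \<longlonglongrightarrow> \<zeta> (0 + 0 *\<^sub>R z)"
      using smooth_continuous[OF S, of UNIV] s(3)
      by (intro continuous_on_tendsto_compose[of UNIV \<zeta>] tendsto_intros) auto
    then show ?thesis by (simp add: \<zeta>n_def \<zeta>0)
  qed
  have [measurable]: "v \<in> borel_measurable borel" "w n \<in> borel_measurable borel" for n
    using v test_fun_integrable[OF Tw] by auto
  have "(\<lambda>n. LINT z|lborel. \<bar>w n z - v z\<bar>) \<longlonglongrightarrow> (LINT z|(lborel::'a measure). 0)"
  proof (rule integral_dominated_convergence[where w="\<lambda>z. \<bar>v z\<bar>"])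
    show "AE z in lborel. (\<lambda>n. \<bar>w n z - v z\<bar>) \<longlonglongrightarrow> 0"
    proof (rule AE_I2)
      fix z
      have "(\<lambda>n. \<bar>v z * \<zeta>n n z - v z\<bar>) \<longlonglongrightarrow> \<bar>v z * 1 - v z\<bar>" by (intro tendsto_intros lim)
      then show "(\<lambda>n. \<bar>w n z - v z\<bar>) \<longlonglongrightarrow> 0" by (simp add: w_def)
    qed
    show "AE z in lborel. norm \<bar>w n z - v z\<bar> \<le> \<bar>v z\<bar>" for n
    proof (rule AE_I2)
      fix z
      have "\<bar>w n z - v z\<bar> = \<bar>v z\<bar> * \<bar>\<zeta>n n z - 1\<bar>"
        unfolding w_def abs_mult[symmetric] by (simp add: algebra_simps)
      also have "\<dots> \<le> \<bar>v z\<bar> * 1"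
        using \<zeta>[of "0 + s n *\<^sub>R z"] by (intro mult_left_mono) (auto simp: \<zeta>n_def)
      finally show "norm \<bar>w n z - v z\<bar> \<le> \<bar>v z\<bar>" by simp
    qed
  qed (use v in auto)
  then have ev0: "\<forall>\<^sub>F n in sequentially. (LINT z|lborel. \<bar>w n z - v z\<bar>) < d"
    using d by (intro order_tendstoD) auto
  have "\<forall>\<^sub>F n in sequentially. (LINT z|lborel. \<bar>pd i (w n) z - pd i v z\<bar>) < d" if i: "i \<in> Basis" for i
  proof -
    obtain C where C: "\<And>z. \<bar>pd i \<zeta> z\<bar> \<le> C" "C > 0" using test_fun_bounded[OF test_fun_pd[OF T i]] by metis
    have [measurable]: "pd i v \<in> borel_measurable borel" "pd i (w n) \<in> borel_measurable borel" for n
      using v(3)[OF i] test_fun_integrable[OF test_fun_pd[OF Tw i]] by auto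
    have "(\<lambda>n. LINT z|lborel. \<bar>pd i (w n) z - pd i v z\<bar>) \<longlonglongrightarrow> (LINT z|(lborel::'a measure). 0)"
    proof (rule integral_dominated_convergence[where w="\<lambda>z. C * \<bar>v z\<bar> + \<bar>pd i v z\<bar>"])
      have b: "\<bar>pd i (\<zeta>n n) z\<bar> \<le> s n * C" for n z
        using C s(1)[of n] by (simp add: pdn abs_mult)
      show "AE z in lborel. (\<lambda>n. \<bar>pd i (w n) z - pd i v z\<bar>) \<longlonglongrightarrow> 0"
      proof (rule AE_I2)
        fix z
        have "(\<lambda>n. s n * C) \<longlonglongrightarrow> 0" using tendsto_mult_left_zero[OF s(3)] .
        then have "(\<lambda>n. pd i (\<zeta>n n) z) \<longlonglongrightarrow> 0"
          by (rule Lim_null_comparison[rotated]) (use b in auto)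
        then have "(\<lambda>n. \<bar>v z * pd i (\<zeta>n n) z + pd i v z * \<zeta>n n z - pd i v z\<bar>) \<longlonglongrightarrow> \<bar>v z * 0 + pd i v z * 1 - pd i v z\<bar>"
          by (intro tendsto_intros lim)
        then show "(\<lambda>n. \<bar>pd i (w n) z - pd i v z\<bar>) \<longlonglongrightarrow> 0" by (simp add: pdw)
      qed
      show "AE z in lborel. norm \<bar>pd i (w n) z - pd i v z\<bar> \<le> C * \<bar>v z\<bar> + \<bar>pd i v z\<bar>" for n
      proof (rule AE_I2)
        fix z
        have "\<bar>v z * pd i (\<zeta>n n) z\<bar> \<le> C * \<bar>v z\<bar>"
        proof -
          have "\<bar>pd i (\<zeta>n n) z\<bar> \<le> C" using b[of n z] s(2)[of n] C(2) by (smt (verit) mult_left_le_one_le s(1))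
          then show ?thesis unfolding abs_mult by (subst mult.commute) (rule mult_right_mono, auto)
        qed
        moreover have "\<bar>pd i v z * (\<zeta>n n z - 1)\<bar> \<le> \<bar>pd i v z\<bar> * 1"
          unfolding abs_mult using \<zeta>[of "0 + s n *\<^sub>R z"] by (intro mult_left_mono) (auto simp: \<zeta>n_def)
        moreover have "pd i (w n) z - pd i v z = v z * pd i (\<zeta>n n) z + pd i v z * (\<zeta>n n z - 1)"
          by (simp add: pdw algebra_simps)
        ultimately show "norm \<bar>pd i (w n) z - pd i v z\<bar> \<le> C * \<bar>v z\<bar> + \<bar>pd i v z\<bar>"
          using abs_triangle_ineq[of "v z * pd i (\<zeta>n n) z" "pd i v z * (\<zeta>n n z - 1)"] by simp
      qed
    qed (use v(2) v(3)[OF i] in auto)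
    then show ?thesis using d by (intro order_tendstoD) auto
  qed
  then have "\<forall>\<^sub>F n in sequentially. \<forall>i\<in>Basis. (LINT z|lborel. \<bar>pd i (w n) z - pd i v z\<bar>) < d"
    by (intro eventually_ball_finite) auto
  with ev0 have "\<forall>\<^sub>F n in sequentially. (LINT z|lborel. \<bar>w n z - v z\<bar>) < d \<and>
      (\<forall>i\<in>Basis. (LINT z|lborel. \<bar>pd i (w n) z - pd i v z\<bar>) < d)"
    by (rule eventually_conj)
  then obtain n where n: "(LINT z|lborel. \<bar>w n z - v z\<bar>) < d"
      "\<forall>i\<in>Basis. (LINT z|lborel. \<bar>pd i (w n) z - pd i v z\<bar>) < d"
    by (auto simp: eventually_sequentially)
  show ?thesis by (rule that[OF Tw[of n]]) (use n in force)+
qed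

lemma set_integral_triangle:
  fixes f g h :: "'a::euclidean_space \<Rightarrow> real"
  assumes I: "integrable lborel f" "integrable lborel g" "integrable lborel h" and S: "S \<in> sets borel"
  shows "(LINT z:S|lborel. \<bar>f z - h z\<bar>) \<le> (LINT z|lborel. \<bar>f z - g z\<bar>) + (LINT z:S|lborel. \<bar>g z - h z\<bar>)"
proof -
  have J: "set_integrable lborel S (\<lambda>z. \<bar>f z - g z\<bar>)" "set_integrable lborel S (\<lambda>z. \<bar>g z - h z\<bar>)"
     "set_integrable lborel S (\<lambda>z. \<bar>f z - h z\<bar>)"
    unfolding set_integrable_def using I S by (auto intro!: integrable_mult_indicator simp del: real_scaleR_def)
  have "(LINT z:S|lborel. \<bar>f z - h z\<bar>) \<le> (LINT z:S|lborel. \<bar>f z - g z\<bar> + \<bar>g z - h z\<bar>)"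
    by (rule set_integral_mono) (use J in auto)
  also have "\<dots> = (LINT z:S|lborel. \<bar>f z - g z\<bar>) + (LINT z:S|lborel. \<bar>g z - h z\<bar>)"
    by (rule set_integral_add(2)[OF J(1,2)])
  also have "(LINT z:S|lborel. \<bar>f z - g z\<bar>) \<le> (LINT z|lborel. \<bar>f z - g z\<bar>)"
    using I S by (intro set_integral_le_integral) auto
  finally show ?thesis by simp
qed

text \<open>Mollification spends one half of d, the cut-off the other. The mollified function is
  smooth on the whole space, but its partials are known to be the mollified weak partials only on
  the half-space; hence the set integrals.\<close>

lemma weak_pd_density:
  fixes u :: "'a::euclidean_space \<times> real \<Rightarrow> real"
  assumes w: "\<And>i. i \<in> Basis \<Longrightarrow> weak_pd i u (G i)" and d: "d > 0"
  obtains v where "test_fun UNIV v" "(LINT z:half_space|lborel. \<bar>v z - u z\<bar>) \<le> d"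
    "\<And>i. i \<in> Basis \<Longrightarrow> (LINT z:half_space|lborel. \<bar>pd i v z - G i z\<bar>) \<le> d"
proof -
  have Iu: "integrable lborel u" using w[OF SOME_Basis] by (simp add: weak_pd_def)
  have IG: "integrable lborel (G i)" if "i \<in> Basis" for i using w[OF that] by (simp add: weak_pd_def)
  obtain e where e: "e > 0" "\<And>\<rho>. mollifier e \<rho> \<Longrightarrow> \<forall>f\<in>insert u (G ` Basis). (LINT z|lborel. \<bar>conv f \<rho> z - f z\<bar>) \<le> d / 2"
  proof -
    have "\<exists>e>0. \<forall>\<rho>. mollifier e \<rho> \<longrightarrow> (\<forall>f\<in>insert u (G ` Basis). (LINT z|lborel. \<bar>conv f \<rho> z - f z\<bar>) \<le> d / 2)"
      by (rule mollifier_approx_finite) (use Iu IG d in auto)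
    then show ?thesis using that by blast
  qed
  obtain \<rho> :: "'a \<times> real \<Rightarrow> real" where \<rho>: "mollifier e \<rho>" "test_fun lower_half_space \<rho>"
    using ex_mollifier_lower[OF e(1)] .
  have T: "test_fun UNIV \<rho>" using \<rho>(1) by (simp add: mollifier_def)
  define c where "c = conv u \<rho>"
  have c: "smooth c" "integrable lborel c" "\<And>i. i \<in> Basis \<Longrightarrow> integrable lborel (pd i c)"
    unfolding c_def using Iu T
    by (auto simp: pd_conv intro!: smooth_conv integrable_conv intro: test_fun_integrable[of UNIV] test_fun_pd)
  obtain v where v: "test_fun UNIV v" "(LINT z|lborel. \<bar>v z - c z\<bar>) \<le> d / 2"
    "\<And>i. i \<in> Basis \<Longrightarrow> (LINT z|lborel. \<bar>pd i v z - pd i c z\<bar>) \<le> d / 2"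
    using smooth_cutoff[OF c, of "d / 2"] d by auto
  show ?thesis
  proof (rule that[OF v(1)])
    have "(LINT z:half_space|lborel. \<bar>c z - u z\<bar>) \<le> (LINT z|lborel. \<bar>c z - u z\<bar>)"
      using c(2) Iu by (intro set_integral_le_integral) auto
    also have "\<dots> \<le> d / 2" using e(2)[OF \<rho>(1)] by (simp add: c_def)
    finally show "(LINT z:half_space|lborel. \<bar>v z - u z\<bar>) \<le> d"
      using set_integral_triangle[OF test_fun_integrable[OF v(1)] c(2) Iu half_space_borel] v(2) by simp
    fix i :: "'a \<times> real" assume i: "i \<in> Basis"
    have "(LINT z:half_space|lborel. \<bar>pd i c z - G i z\<bar>) = (LINT z:half_space|lborel. \<bar>conv (G i) \<rho> z - G i z\<bar>)"
      unfolding set_lebesgue_integral_def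
      by (intro Bochner_Integration.integral_cong)
        (auto simp: indicator_def c_def pd_conv_weak[OF w[OF i] i _ \<rho>(2)])
    also have "\<dots> \<le> (LINT z|lborel. \<bar>conv (G i) \<rho> z - G i z\<bar>)"
      using IG[OF i] test_fun_integrable[OF T]
      by (intro set_integral_le_integral Bochner_Integration.integrable_diff integrable_conv) auto
    also have "\<dots> \<le> d / 2" using e(2)[OF \<rho>(1)] i by simp
    finally show "(LINT z:half_space|lborel. \<bar>pd i v z - G i z\<bar>) \<le> d"
      using set_integral_triangle[OF test_fun_integrable[OF test_fun_pd[OF v(1) i]] c(3)[OF i] IG[OF i] half_space_borel] v(3)[OF i]
      by simp
  qed
qed

section \<open>Weak gradients and traces\<close>

text \<open>The representative is a Borel function integrable over the whole space, so that
  convolution and Fubini apply. It is tied to f only on the half-space, in line with the convention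
  that values elsewhere do not count.\<close>

definition borel_rep :: "('a::euclidean_space \<times> real \<Rightarrow> real) \<Rightarrow> ('a \<times> real \<Rightarrow> real) \<Rightarrow> bool" where
  "borel_rep f f' \<longleftrightarrow> integrable lborel f' \<and> (AE z in lborel. z \<in> half_space \<longrightarrow> f z = f' z)"

lemma borel_rep_diff:
  assumes "borel_rep f f'" "borel_rep g g'"
  shows "borel_rep (\<lambda>z. f z - g z) (\<lambda>z. f' z - g' z)"
  unfolding borel_rep_def
proof
  show "integrable lborel (\<lambda>z. f' z - g' z)" using assms by (simp add: borel_rep_def)
  have "AE z in lborel. z \<in> half_space \<longrightarrow> f z = f' z" "AE z in lborel. z \<in> half_space \<longrightarrow> g z = g' z"
    using assms by (simp_all add: borel_rep_def)
  then show "AE z in lborel. z \<in> half_space \<longrightarrow> f z - g z = f' z - g' z" by eventually_elim auto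
qed

lemma borel_representative:
  fixes f :: "'a::euclidean_space \<times> real \<Rightarrow> real"
  assumes "f absolutely_integrable_on half_space"
  obtains f' where "borel_rep f f'"
proof -
  \<comment> \<open>Extension by zero makes f integrable over the whole space; a function measurable
    for the completion agrees almost everywhere with a Borel one.\<close>
  define F where "F z = indicator half_space z *\<^sub>R f z" for z
  have F: "integrable lebesgue F" using assms unfolding set_integrable_def F_def .
  then have "F \<in> borel_measurable lebesgue" by (rule borel_measurable_integrable)
  then obtain f' where f': "f' \<in> borel_measurable lborel" "AE z in lborel. F z = f' z"
    using completion_ex_borel_measurable_real[of F lborel] by blast
  have "integrable lebesgue f'"
    using F f'(2) measurable_completion[OF f'(1)]
    by (intro integrable_cong_AE_imp[of lebesgue F f'] AE_completion) (auto elim: eventually_mono)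
  then have "integrable lborel f'" using integrable_completion[OF f'(1)] by simp
  moreover have "AE z in lborel. z \<in> half_space \<longrightarrow> f z = f' z"
    using f'(2) by (rule eventually_mono) (auto simp: F_def)
  ultimately show ?thesis using that by (simp add: borel_rep_def)
qed

lemma borel_representative_vector:
  fixes g :: "'a::euclidean_space \<times> real \<Rightarrow> 'a \<times> real"
  assumes "g absolutely_integrable_on half_space"
  obtains G where "\<forall>i\<in>Basis. borel_rep (\<lambda>z. g z \<bullet> i) (G i)"
proof -
  have "\<forall>i\<in>Basis. \<exists>h. borel_rep (\<lambda>z. g z \<bullet> i) h"
    using borel_representative[OF absolutely_integrable_component[OF assms]] by metis
  from bchoice[OF this] show ?thesis using that by blast
qed

lemma set_integral_representative:
  fixes p q :: "'a::euclidean_space \<times> real \<Rightarrow> real"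
  assumes p: "(\<lambda>z. indicator half_space z *\<^sub>R p z) \<in> borel_measurable lebesgue"
    and q: "q \<in> borel_measurable borel" and eq: "AE z in lborel. z \<in> half_space \<longrightarrow> p z = q z"
  shows "(LINT z:half_space|lebesgue. p z) = (LINT z:half_space|lborel. q z)"
proof -
  have qm: "(\<lambda>z. indicator half_space z *\<^sub>R q z) \<in> borel_measurable lborel"
    using q by auto
  have "(LINT z:half_space|lebesgue. p z) = (LINT z|lebesgue. indicator half_space z *\<^sub>R q z)"
    unfolding set_lebesgue_integral_def
    by (rule integral_cong_AE[OF p measurable_completion[OF qm]], rule AE_completion, rule eventually_mono[OF eq])
      (auto simp: indicator_def)
  then show ?thesis
    using integral_completion[OF qm] by (simp add: set_lebesgue_integral_def)
qed

text \<open>Products with a test function vanish off the half-space and their integrals ignore null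
  sets, so representatives do not change the defining identity. Uniqueness uses one direction;
  closure under differences uses both.\<close>

lemma has_weak_grad_iff_weak_pd:
  fixes u :: "'a::euclidean_space \<times> real \<Rightarrow> real"
  assumes u: "u absolutely_integrable_on half_space" and g: "g absolutely_integrable_on half_space"
    and u': "borel_rep u u'" and G: "\<forall>i\<in>Basis. borel_rep (\<lambda>z. g z \<bullet> i) (G i)"
  shows "has_weak_grad half_space u g \<longleftrightarrow> (\<forall>i\<in>Basis. weak_pd i u' (G i))"
proof -
  have *: "(LINT z:half_space|lebesgue. p z * \<phi> z) = (LINT z|lborel. q z * \<phi> z)"
    if p: "p absolutely_integrable_on half_space" and pq: "borel_rep p q" and \<phi>: "test_fun half_space \<phi>"
    for p q \<phi> :: "'a \<times> real \<Rightarrow> real"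
  proof -
    have q: "integrable lborel q" and eq: "AE z in lborel. z \<in> half_space \<longrightarrow> p z = q z"
      using pq by (simp_all add: borel_rep_def)
    have m: "\<phi> \<in> borel_measurable borel" using \<phi> by (intro smooth_measurable test_fun_smooth)
    then have m': "\<phi> \<in> borel_measurable lebesgue" by (intro measurable_completion) simp
    have "(\<lambda>z. (indicator half_space z *\<^sub>R p z) * \<phi> z) \<in> borel_measurable lebesgue"
      using p m' unfolding set_integrable_def by (intro borel_measurable_times[OF borel_measurable_integrable])
    then have "(LINT z:half_space|lebesgue. p z * \<phi> z) = (LINT z:half_space|lborel. q z * \<phi> z)"
      using q m by (intro set_integral_representative eventually_mono[OF eq]) (auto simp: mult.assoc)
    also have "\<dots> = (LINT z|lborel. q z * \<phi> z)"
      unfolding set_lebesgue_integral_def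
    proof (intro Bochner_Integration.integral_cong refl)
      fix z
      have "z \<notin> half_space \<Longrightarrow> \<phi> z = 0" using \<phi> unfolding test_fun_def by blast
      then show "indicator half_space z *\<^sub>R (q z * \<phi> z) = q z * \<phi> z" by (cases "z \<in> half_space") auto
    qed
    finally show ?thesis .
  qed
  have "(LINT z:half_space|lebesgue. u z * pd i \<phi> z) = (LINT z|lborel. u' z * pd i \<phi> z)"
    "(LINT z:half_space|lebesgue. (g z \<bullet> i) * \<phi> z) = (LINT z|lborel. G i z * \<phi> z)"
    if "test_fun half_space \<phi>" "i \<in> Basis" for \<phi> i
    using that G *[OF u u' test_fun_pd] *[OF absolutely_integrable_component[OF g]] by blast+
  then show ?thesis
    using u g u' G unfolding has_weak_grad_def weak_pd_def borel_rep_def by auto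
qed

lemma has_weak_grad_unique:
  fixes u :: "'a::euclidean_space \<times> real \<Rightarrow> real"
  assumes g: "has_weak_grad half_space u g" and h: "has_weak_grad half_space u h"
  shows "AE z in lborel. z \<in> half_space \<longrightarrow> g z = h z"
proof -
  have I: "u absolutely_integrable_on half_space" "g absolutely_integrable_on half_space"
      "h absolutely_integrable_on half_space"
    using g h by (auto simp: has_weak_grad_def)
  obtain u' where u': "borel_rep u u'"
    using borel_representative[OF I(1)] .
  obtain G where G: "\<forall>i\<in>Basis. borel_rep (\<lambda>z. g z \<bullet> i) (G i)"
    using borel_representative_vector[OF I(2)] .
  obtain H where H: "\<forall>i\<in>Basis. borel_rep (\<lambda>z. h z \<bullet> i) (H i)"
    using borel_representative_vector[OF I(3)] .
  have "AE z in lborel. z \<in> half_space \<longrightarrow> g z \<bullet> i = h z \<bullet> i" if i: "i \<in> Basis" for i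
  proof -
    have "weak_pd i u' (G i)" "weak_pd i u' (H i)"
      using has_weak_grad_iff_weak_pd[OF I(1,2) u' G] has_weak_grad_iff_weak_pd[OF I(1,3) u' H] g h i by auto
    from weak_pd_unique[OF this i] have "AE z in lborel. z \<in> half_space \<longrightarrow> G i z = H i z" .
    moreover have "AE z in lborel. z \<in> half_space \<longrightarrow> g z \<bullet> i = G i z"
      "AE z in lborel. z \<in> half_space \<longrightarrow> h z \<bullet> i = H i z"
      using G H i by (simp_all add: borel_rep_def)
    ultimately show ?thesis by eventually_elim auto
  qed
  then have "AE z in lborel. \<forall>i\<in>Basis. z \<in> half_space \<longrightarrow> g z \<bullet> i = h z \<bullet> i"
    by (intro eventually_ball_finite) auto
  then show ?thesis by (rule eventually_mono) (auto intro: euclidean_eqI)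
qed

lemma has_weak_grad_diff:
  fixes u :: "'a::euclidean_space \<times> real \<Rightarrow> real"
  assumes u: "has_weak_grad half_space u g" and v: "has_weak_grad half_space v h"
  shows "has_weak_grad half_space (\<lambda>z. u z - v z) (\<lambda>z. g z - h z)"
proof -
  have I: "u absolutely_integrable_on half_space" "g absolutely_integrable_on half_space"
      "v absolutely_integrable_on half_space" "h absolutely_integrable_on half_space"
    using u v by (auto simp: has_weak_grad_def)
  obtain u' where u': "borel_rep u u'"
    using borel_representative[OF I(1)] .
  obtain v' where v': "borel_rep v v'"
    using borel_representative[OF I(3)] .
  obtain G where G: "\<forall>i\<in>Basis. borel_rep (\<lambda>z. g z \<bullet> i) (G i)"
    using borel_representative_vector[OF I(2)] .
  obtain H where H: "\<forall>i\<in>Basis. borel_rep (\<lambda>z. h z \<bullet> i) (H i)"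
    using borel_representative_vector[OF I(4)] .
  have D: "(\<lambda>z. u z - v z) absolutely_integrable_on half_space"
      "(\<lambda>z. g z - h z) absolutely_integrable_on half_space"
    using I by (auto intro: set_integral_diff)
  have GH: "\<forall>i\<in>Basis. borel_rep (\<lambda>z. (g z - h z) \<bullet> i) (\<lambda>z. G i z - H i z)"
    using G H by (simp add: inner_diff_left borel_rep_diff)
  have "\<forall>i\<in>Basis. weak_pd i u' (G i)" "\<forall>i\<in>Basis. weak_pd i v' (H i)"
    using has_weak_grad_iff_weak_pd[OF I(1,2) u' G] has_weak_grad_iff_weak_pd[OF I(3,4) v' H] u v by auto
  then have "\<forall>i\<in>Basis. weak_pd i (\<lambda>z. u' z - v' z) (\<lambda>z. G i z - H i z)"
    by (auto intro: weak_pd_diff)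
  then show ?thesis using has_weak_grad_iff_weak_pd[OF D borel_rep_diff[OF u' v'] GH] by blast
qed

section \<open>Norms of weak gradients, independent of the representative\<close>

lemma has_weak_grad_weak_grad: "has_weak_grad \<Omega> u g \<Longrightarrow> has_weak_grad \<Omega> u (weak_grad \<Omega> u)"
  unfolding weak_grad_def by (rule someI[of "has_weak_grad \<Omega> u"])

text \<open>Uniqueness almost everywhere neutralises the choice made in \<open>weak_grad\<close>:
  any weak gradient at hand computes the integral.\<close>

lemma integral_norm_weak_grad:
  fixes u :: "'a::euclidean_space \<times> real \<Rightarrow> real"
  assumes g: "has_weak_grad half_space u g"
  shows "(LINT z:half_space|lebesgue. norm (weak_grad half_space u z)) = (LINT z:half_space|lebesgue. norm (g z))"
proof -
  note h = has_weak_grad_weak_grad[OF g]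
  have "(\<lambda>z. norm (g z)) absolutely_integrable_on half_space"
    "(\<lambda>z. norm (weak_grad half_space u z)) absolutely_integrable_on half_space"
    using g h absolutely_integrable_norm[where f=g]
      absolutely_integrable_norm[where f="weak_grad half_space u"]
    by (simp_all add: has_weak_grad_def o_def)
  then have m: "(\<lambda>z. indicator half_space z *\<^sub>R norm (g z)) \<in> borel_measurable lebesgue"
    "(\<lambda>z. indicator half_space z *\<^sub>R norm (weak_grad half_space u z)) \<in> borel_measurable lebesgue"
    unfolding set_integrable_def by (auto dest: borel_measurable_integrable simp del: real_scaleR_def)
  show ?thesis
    unfolding set_lebesgue_integral_def
    by (rule integral_cong_AE[OF m(2,1)], rule AE_completion, rule eventually_mono[OF has_weak_grad_unique[OF h g]])
      (auto simp: indicator_def)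
qed

text \<open>The Euclidean norm lies between each absolute component and their sum. The upper bound
  serves density and the estimate of \<open>J\<close> for bumps; the lower one, for the vertical
  component, serves the trace inequality.\<close>

lemma integral_norm_le_sum:
  fixes g :: "'a::euclidean_space \<times> real \<Rightarrow> 'a \<times> real"
  assumes g: "g absolutely_integrable_on half_space"
    and G: "\<forall>i\<in>Basis. borel_rep (\<lambda>z. g z \<bullet> i) (G i)"
  shows "(LINT z:half_space|lebesgue. norm (g z)) \<le> (\<Sum>i\<in>Basis. LINT z:half_space|lborel. \<bar>G i z\<bar>)"
    and "i \<in> Basis \<Longrightarrow> (LINT z:half_space|lborel. \<bar>G i z\<bar>) \<le> (LINT z:half_space|lebesgue. norm (g z))"
proof -
  have I: "(\<lambda>z. \<bar>g z \<bullet> i\<bar>) absolutely_integrable_on half_space" for i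
    using absolutely_integrable_norm[OF absolutely_integrable_component[OF g, of i]] by (simp add: o_def)
  have In: "(\<lambda>z. norm (g z)) absolutely_integrable_on half_space"
    using absolutely_integrable_norm[OF g] by (simp add: o_def)
  have eq: "(LINT z:half_space|lebesgue. \<bar>g z \<bullet> i\<bar>) = (LINT z:half_space|lborel. \<bar>G i z\<bar>)" if i: "i \<in> Basis" for i
  proof (rule set_integral_representative)
    show "(\<lambda>z. indicator half_space z *\<^sub>R \<bar>g z \<bullet> i\<bar>) \<in> borel_measurable lebesgue"
      using I unfolding set_integrable_def by (rule borel_measurable_integrable)
    have Gi: "integrable lborel (G i)" "AE z in lborel. z \<in> half_space \<longrightarrow> g z \<bullet> i = G i z"
      using G i by (simp_all add: borel_rep_def)
    show "(\<lambda>z. \<bar>G i z\<bar>) \<in> borel_measurable borel" using Gi(1) by auto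
    show "AE z in lborel. z \<in> half_space \<longrightarrow> \<bar>g z \<bullet> i\<bar> = \<bar>G i z\<bar>"
      by (rule eventually_mono[OF Gi(2)]) auto
  qed
  have "(LINT z:half_space|lebesgue. norm (g z)) \<le> (LINT z:half_space|lebesgue. (\<Sum>i\<in>Basis. \<bar>g z \<bullet> i\<bar>))"
  proof (rule set_integral_mono[OF In])
    show "set_integrable lebesgue half_space (\<lambda>z. \<Sum>i\<in>Basis. \<bar>g z \<bullet> i\<bar>)"
      using I unfolding set_integrable_def scaleR_sum_right
      by (intro Bochner_Integration.integrable_sum) auto
  qed (rule norm_le_l1)
  also have "\<dots> = (\<Sum>i\<in>Basis. LINT z:half_space|lebesgue. \<bar>g z \<bullet> i\<bar>)"
    using I unfolding set_lebesgue_integral_def set_integrable_def scaleR_sum_right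
    by (intro Bochner_Integration.integral_sum) auto
  finally show "(LINT z:half_space|lebesgue. norm (g z)) \<le> (\<Sum>i\<in>Basis. LINT z:half_space|lborel. \<bar>G i z\<bar>)"
    using eq by simp
  assume i: "i \<in> Basis"
  show "(LINT z:half_space|lborel. \<bar>G i z\<bar>) \<le> (LINT z:half_space|lebesgue. norm (g z))"
    unfolding eq[OF i, symmetric] by (rule set_integral_mono[OF I In]) (rule Basis_le_norm[OF i])
qed

lemma has_weak_grad_test_fun:
  assumes "test_fun UNIV (v :: 'a::euclidean_space \<times> real \<Rightarrow> real)"
  shows "has_weak_grad half_space v (grad v)"
  using assms test_fun_integrable[OF assms] test_fun_integrable[OF test_fun_pd[OF assms]]
  by (intro has_weak_grad_smooth) (auto intro: test_fun_smooth)

text \<open>The first bound turns componentwise approximation into approximation in W^{1,1}; the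
  second recovers a single partial, as the trace estimate requires.\<close>

lemma W11_norm_bounds:
  fixes u :: "'a::euclidean_space \<times> real \<Rightarrow> real"
  assumes u: "has_weak_grad half_space u g" and v: "test_fun UNIV v"
    and u': "borel_rep u u'" and G: "\<forall>i\<in>Basis. borel_rep (\<lambda>z. g z \<bullet> i) (G i)"
  shows "W11_norm half_space (\<lambda>z. v z - u z) \<le> (LINT z:half_space|lborel. \<bar>v z - u' z\<bar>) +
      (\<Sum>i\<in>Basis. LINT z:half_space|lborel. \<bar>pd i v z - G i z\<bar>)"
    and "i \<in> Basis \<Longrightarrow> (LINT z:half_space|lborel. \<bar>pd i v z - G i z\<bar>) \<le> W11_norm half_space (\<lambda>z. v z - u z)"
proof -
  note vu = has_weak_grad_diff[OF has_weak_grad_test_fun[OF v] u]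
  have I: "(\<lambda>z. v z - u z) absolutely_integrable_on half_space"
      "(\<lambda>z. grad v z - g z) absolutely_integrable_on half_space"
    using vu by (auto simp: has_weak_grad_def)
  have "(\<lambda>z. \<bar>v z - u z\<bar>) absolutely_integrable_on half_space"
    using absolutely_integrable_norm[OF I(1)] by (simp add: o_def)
  then have m: "(\<lambda>z. indicator half_space z *\<^sub>R \<bar>v z - u z\<bar>) \<in> borel_measurable lebesgue"
    unfolding set_integrable_def by (rule borel_measurable_integrable)
  have Iv: "integrable lborel (\<lambda>z. v z - u' z)" using test_fun_integrable[OF v] u' by (auto simp: borel_rep_def)
  then have m': "(\<lambda>z. \<bar>v z - u' z\<bar>) \<in> borel_measurable borel" by auto
  have e1: "(LINT z:half_space|lebesgue. \<bar>v z - u z\<bar>) = (LINT z:half_space|lborel. \<bar>v z - u' z\<bar>)"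
  proof (rule set_integral_representative[OF m m'])
    have "AE z in lborel. z \<in> half_space \<longrightarrow> u z = u' z" using u' by (simp add: borel_rep_def)
    then show "AE z in lborel. z \<in> half_space \<longrightarrow> \<bar>v z - u z\<bar> = \<bar>v z - u' z\<bar>"
      by (rule eventually_mono) auto
  qed
  note e2 = integral_norm_weak_grad[OF vu]
  have "borel_rep (\<lambda>z. grad v z \<bullet> i) (pd i v)" if "i \<in> Basis" for i
    using that test_fun_integrable[OF test_fun_pd[OF v that]] by (simp add: borel_rep_def)
  then have GG: "\<forall>i\<in>Basis. borel_rep (\<lambda>z. (grad v z - g z) \<bullet> i) (\<lambda>z. pd i v z - G i z)"
    using G by (simp add: inner_diff_left borel_rep_diff)
  note b = integral_norm_le_sum[OF I(2) GG]
  show "W11_norm half_space (\<lambda>z. v z - u z) \<le> (LINT z:half_space|lborel. \<bar>v z - u' z\<bar>) +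
      (\<Sum>i\<in>Basis. LINT z:half_space|lborel. \<bar>pd i v z - G i z\<bar>)"
    unfolding W11_norm_def e1 e2 using b(1) by simp
  have "(LINT z:half_space|lebesgue. \<bar>v z - u z\<bar>) \<ge> 0"
    unfolding set_lebesgue_integral_def by (intro Bochner_Integration.integral_nonneg) auto
  then show "(LINT z:half_space|lborel. \<bar>pd i v z - G i z\<bar>) \<le> W11_norm half_space (\<lambda>z. v z - u z)"
    if "i \<in> Basis"
    unfolding W11_norm_def e2 using b(2)[OF that] by simp
qed

lemma W11_norm_nonneg: "W11_norm \<Omega> u \<ge> 0"
  unfolding W11_norm_def set_lebesgue_integral_def
  by (intro add_nonneg_nonneg Bochner_Integration.integral_nonneg) auto

text \<open>The argument \<open>g\<close> is the vertical derivative of the function whose trace is taken.\<close>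

definition trace_of :: "('a::euclidean_space \<times> real \<Rightarrow> real) \<Rightarrow> 'a \<Rightarrow> real" where
  "trace_of g x = - (LINT y|lborel. indicator {0<..} y * g (x, y))"

text \<open>Fubini along vertical half-lines. The signed identity stands beside the inequality
  because it gives an exact value when the vertical derivative has constant sign.\<close>

lemma trace_of_integrable:
  fixes g :: "'a::euclidean_space \<times> real \<Rightarrow> real"
  assumes g: "integrable lborel g"
  shows "AE x in lborel. integrable lborel (\<lambda>y. indicator {0<..} y * g (x, y))"
    and "integrable lborel (trace_of g)"
    and "(LINT x|lborel. trace_of g x) = - (LINT z:half_space|lborel. g z)"
    and "(LINT x|lborel. \<bar>trace_of g x\<bar>) \<le> (LINT z:half_space|lborel. \<bar>g z\<bar>)"
proof -
  define F where "F z = indicator half_space z *\<^sub>R g z" for z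
  have F: "F (x, y) = indicator {0<..} y * g (x, y)" for x y
    by (simp add: F_def half_space_def indicator_def)
  have IF: "integrable (lborel \<Otimes>\<^sub>M lborel) F"
    using integrable_mult_indicator[OF _ g, of half_space] by (simp add: F_def[abs_def] lborel_prod)
  show "AE x in lborel. integrable lborel (\<lambda>y. indicator {0<..} y * g (x, y))"
    using lborel_pair.AE_integrable_fst'[OF IF] by (simp add: F)
  show It: "integrable lborel (trace_of g)"
    using lborel_pair.integrable_fst'[OF IF] by (simp add: F trace_of_def[abs_def])
  show "(LINT x|lborel. trace_of g x) = - (LINT z:half_space|lborel. g z)"
    using lborel_pair.integral_fst'[OF IF]
    by (simp only: F trace_of_def set_lebesgue_integral_def lborel_prod F_def[symmetric] Bochner_Integration.integral_minus)
  have IF': "integrable (lborel \<Otimes>\<^sub>M lborel) (\<lambda>z. \<bar>F z\<bar>)" using IF by simp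
  have "(LINT x|lborel. \<bar>trace_of g x\<bar>) \<le> (LINT x|lborel. LINT y|lborel. \<bar>F (x, y)\<bar>)"
  proof (rule integral_mono)
    show "integrable lborel (\<lambda>x. \<bar>trace_of g x\<bar>)" using It by simp
    show "integrable lborel (\<lambda>x. LINT y|lborel. \<bar>F (x, y)\<bar>)"
      using lborel_pair.integrable_fst'[OF IF'] by simp
    show "\<bar>trace_of g x\<bar> \<le> (LINT y|lborel. \<bar>F (x, y)\<bar>)" for x
      using integral_norm_bound[of lborel "\<lambda>y. F (x, y)"] by (simp add: trace_of_def F)
  qed
  also have "\<dots> = (LINT z|lborel. \<bar>F z\<bar>)"
    using lborel_pair.integral_fst'[OF IF'] by (simp add: lborel_prod)
  also have "\<dots> = (LINT z:half_space|lborel. \<bar>g z\<bar>)"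
    by (simp add: set_lebesgue_integral_def F_def abs_mult)
  finally show "(LINT x|lborel. \<bar>trace_of g x\<bar>) \<le> (LINT z:half_space|lborel. \<bar>g z\<bar>)" .
qed

lemma trace_of_diff:
  fixes g h :: "'a::euclidean_space \<times> real \<Rightarrow> real"
  assumes "integrable lborel g" "integrable lborel h"
  shows "AE x in lborel. trace_of (\<lambda>z. g z - h z) x = trace_of g x - trace_of h x"
  using trace_of_integrable(1)[OF assms(1)] trace_of_integrable(1)[OF assms(2)]
  by eventually_elim (simp add: trace_of_def right_diff_distrib)

lemma vertical_Basis: "(0, 1::real) \<in> Basis"
  by (simp add: Basis_prod_def)

lemma trace_of_test_fun:
  fixes v :: "'a::euclidean_space \<times> real \<Rightarrow> real"
  assumes v: "test_fun UNIV v"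
  shows "trace_of (pd (0, 1) v) x = v (x, 0)"
proof -
  obtain K where K: "compact K" "\<And>z. z \<notin> K \<Longrightarrow> v z = 0"
    using v unfolding test_fun_def by blast
  obtain R where R: "\<And>z. z \<in> K \<Longrightarrow> norm z \<le> R" "R > 0"
    using compact_imp_bounded[OF K(1)] by (auto simp: bounded_pos)
  have 0: "v (x, y) = 0" "pd (0, 1) v (x, y) = 0" if "y > R" for y
  proof -
    have "(x, y) \<notin> K" using R(1)[of "(x, y)"] norm_snd_le[of y x] that by auto
    then show "v (x, y) = 0" "pd (0, 1) v (x, y) = 0"
      using K(2) pd_eq_0_outside[OF compact_imp_closed[OF K(1)], of v] by auto
  qed
  have S: "smooth v" "smooth (pd (0, 1) v)"
    using v test_fun_smooth smooth_pd[OF _ vertical_Basis] by blast+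
  have D: "((\<lambda>y. v (x, y)) has_real_derivative pd (0, 1) v (x, y)) (at y)" for y
  proof -
    have Dv: "(v has_derivative (\<lambda>h. pd h v (x, y))) (at (x, y))"
      by (rule pd_has_derivative[OF smooth_differentiable[OF S(1)]])
    have "((\<lambda>y. v (x, y)) has_derivative (\<lambda>t. pd (0, t) v (x, y))) (at y)"
      by (rule has_derivative_compose[where f="\<lambda>y. (x, y)", OF _ Dv]) (auto intro!: derivative_eq_intros)
    moreover have "pd (0, t) v (x, y) = pd (0, 1) v (x, y) * t" for t
      using linear_scale[OF has_derivative_linear[OF Dv], of t "(0, 1)"] by simp
    then have "(\<lambda>t. pd (0, t) v (x, y)) = (*) (pd (0, 1) v (x, y))" by blast
    ultimately show ?thesis by (simp only: has_field_derivative_def)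
  qed
  have cont: "continuous_on S (\<lambda>y. pd (0, 1) v (x, y))" for S
    by (rule continuous_on_compose2[OF smooth_continuous[OF S(2), of UNIV]]) (auto intro!: continuous_intros)
  \<comment> \<open>The two domains differ at the single point 0 and above R, where the derivative
    vanishes. The endpoint R + 1 lies strictly above R, so v is zero there too.\<close>
  have "(LINT y|lborel. indicator {0<..} y * pd (0, 1) v (x, y))
      = (LINT y|lborel. pd (0, 1) v (x, y) * indicator {0..R + 1} y)"
  proof (rule integral_cong_AE)
    have [measurable]: "(\<lambda>y. pd (0, 1) v (x, y)) \<in> borel_measurable borel"
      by (rule borel_measurable_continuous_onI[OF cont])
    show "(\<lambda>y. indicator {0<..} y * pd (0, 1) v (x, y)) \<in> borel_measurable lborel"
      "(\<lambda>y. pd (0, 1) v (x, y) * indicator {0..R + 1} y) \<in> borel_measurable lborel"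
      by measurable
    show "AE y in lborel. indicator {0<..} y * pd (0, 1) v (x, y) = pd (0, 1) v (x, y) * indicator {0..R + 1} y"
      using AE_lborel_singleton[of 0] by eventually_elim (use 0(2) in \<open>force simp: indicator_def\<close>)
  qed
  also have "\<dots> = v (x, R + 1) - v (x, 0)"
  proof (rule integral_FTC_Icc_real)
    show "isCont (\<lambda>y. pd (0, 1) v (x, y)) y" for y
      using cont[of UNIV] by (simp add: continuous_on_eq_continuous_at)
  qed (use R(2) D in auto)
  finally show ?thesis using 0(1)[of "R + 1"] by (simp add: trace_of_def)
qed

section \<open>The infimum\<close>

text \<open>\<open>trace_of\<close> is linear up to a null set and returns v(.,0) for a test
  function v, so the difference of traces is \<open>trace_of\<close> of a difference of vertical
  derivatives, to which the L^1 bound applies.\<close>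

lemma integral_trace_test_fun_diff:
  fixes v :: "'a::euclidean_space \<times> real \<Rightarrow> real"
  assumes v: "test_fun UNIV v" and g: "integrable lborel g"
  shows "integrable lborel (\<lambda>x. v (x, 0))"
    and "(LINT x|lborel. \<bar>v (x, 0) - trace_of g x\<bar>) \<le> (LINT z:half_space|lborel. \<bar>pd (0, 1) v z - g z\<bar>)"
proof -
  note Iv = test_fun_integrable[OF test_fun_pd[OF v vertical_Basis]]
  have e: "trace_of (pd (0, 1) v) = (\<lambda>x. v (x, 0))"
    using trace_of_test_fun[OF v] by blast
  show I: "integrable lborel (\<lambda>x. v (x, 0))"
    using trace_of_integrable(2)[OF Iv] by (simp add: e)
  have D: "integrable lborel (\<lambda>z. pd (0, 1) v z - g z)" using Iv g by simp
  have "(LINT x|lborel. \<bar>v (x, 0) - trace_of g x\<bar>) = (LINT x|lborel. \<bar>trace_of (\<lambda>z. pd (0, 1) v z - g z) x\<bar>)"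
  proof (rule integral_cong_AE)
    show "(\<lambda>x. \<bar>v (x, 0) - trace_of g x\<bar>) \<in> borel_measurable lborel"
      using I trace_of_integrable(2)[OF g] by auto
    show "(\<lambda>x. \<bar>trace_of (\<lambda>z. pd (0, 1) v z - g z) x\<bar>) \<in> borel_measurable lborel"
      using trace_of_integrable(2)[OF D] by auto
    show "AE x in lborel. \<bar>v (x, 0) - trace_of g x\<bar> = \<bar>trace_of (\<lambda>z. pd (0, 1) v z - g z) x\<bar>"
      using trace_of_diff[OF Iv g] by eventually_elim (simp add: trace_of_test_fun[OF v])
  qed
  also have "\<dots> \<le> (LINT z:half_space|lborel. \<bar>pd (0, 1) v z - g z\<bar>)"
    by (rule trace_of_integrable(4)[OF D])
  finally show "(LINT x|lborel. \<bar>v (x, 0) - trace_of g x\<bar>) \<le> (LINT z:half_space|lborel. \<bar>pd (0, 1) v z - g z\<bar>)" .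
qed

context
  fixes u u' :: "'a::euclidean_space \<times> real \<Rightarrow> real" and g G
  assumes u: "has_weak_grad half_space u g"
    and u': "borel_rep u u'" and G: "\<forall>i\<in>Basis. borel_rep (\<lambda>z. g z \<bullet> i) (G i)"
begin

lemma vertical_integrable: "integrable lborel (G (0, 1))"
  using G vertical_Basis by (auto simp: borel_rep_def)

text \<open>Continuity of the trace in W^{1,1}, the estimate behind both its existence and its
  uniqueness.\<close>

lemma integral_trace_diff_le_W11_norm:
  assumes v: "test_fun UNIV v"
  shows "(LINT x|lborel. \<bar>v (x, 0) - trace_of (G (0, 1)) x\<bar>) \<le> W11_norm half_space (\<lambda>z. v z - u z)"
  using integral_trace_test_fun_diff(2)[OF v vertical_integrable]
    W11_norm_bounds(2)[OF u v u' G vertical_Basis] by simp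

lemma has_trace_trace_of: "has_trace u (trace_of (G (0, 1)))"
proof -
  have I: "u absolutely_integrable_on half_space" "g absolutely_integrable_on half_space"
    using u by (auto simp: has_weak_grad_def)
  have w: "weak_pd i u' (G i)" if "i \<in> Basis" for i
    using has_weak_grad_iff_weak_pd[OF I u' G] u that by blast
  \<comment> \<open>One unit for the function and one for each partial, all approximated to within 1
    / (k + 1).\<close>
  define N where "N = 1 + real (card (Basis :: ('a \<times> real) set))"
  have "\<exists>v. test_fun UNIV v \<and> W11_norm half_space (\<lambda>z. v z - u z) \<le> N * inverse (real (Suc k))" for k
  proof -
    obtain v where v: "test_fun UNIV v" "(LINT z:half_space|lborel. \<bar>v z - u' z\<bar>) \<le> inverse (real (Suc k))"
      "\<And>i. i \<in> Basis \<Longrightarrow> (LINT z:half_space|lborel. \<bar>pd i v z - G i z\<bar>) \<le> inverse (real (Suc k))"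
      using weak_pd_density[OF w, of "inverse (real (Suc k))"] by auto
    have "(\<Sum>i\<in>Basis. LINT z:half_space|lborel. \<bar>pd i v z - G i z\<bar>)
        \<le> (\<Sum>i\<in>(Basis :: ('a \<times> real) set). inverse (real (Suc k)))"
      by (rule sum_mono) (rule v(3))
    then have "W11_norm half_space (\<lambda>z. v z - u z) \<le> N * inverse (real (Suc k))"
      using W11_norm_bounds(1)[OF u v(1) u' G] v(2) by (simp add: N_def distrib_right)
    then show ?thesis using v(1) by blast
  qed
  then obtain v where v: "\<And>k. test_fun UNIV (v k)"
      "\<And>k. W11_norm half_space (\<lambda>z. v k z - u z) \<le> N * inverse (real (Suc k))"
    by metis
  have lim: "(\<lambda>k. W11_norm half_space (\<lambda>z. v k z - u z)) \<longlonglongrightarrow> 0"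
  proof (rule tendsto_sandwich[OF _ _ tendsto_const])
    show "(\<lambda>k. N * inverse (real (Suc k))) \<longlonglongrightarrow> 0"
      using tendsto_mult_right_zero[OF LIMSEQ_inverse_real_of_nat] .
  qed (use v(2) W11_norm_nonneg in \<open>auto intro!: always_eventually\<close>)
  have tr: "integrable lborel (trace_of (G (0, 1)))"
    by (rule trace_of_integrable(2)[OF vertical_integrable])
  have "(LINT x|lebesgue. \<bar>v k (x, 0) - trace_of (G (0, 1)) x\<bar>)
      = (LINT x|lborel. \<bar>v k (x, 0) - trace_of (G (0, 1)) x\<bar>)" for k
    using tr integral_trace_test_fun_diff(1)[OF v(1) vertical_integrable]
    by (intro integral_completion) auto
  then have le: "(LINT x|lebesgue. \<bar>v k (x, 0) - trace_of (G (0, 1)) x\<bar>) \<le> W11_norm half_space (\<lambda>z. v k z - u z)" for k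
    using integral_trace_diff_le_W11_norm[OF v(1)] by simp
  have lim': "(\<lambda>k. LINT x|lebesgue. \<bar>v k (x, 0) - trace_of (G (0, 1)) x\<bar>) \<longlonglongrightarrow> 0"
    by (rule tendsto_sandwich[OF _ _ tendsto_const lim])
      (use le in \<open>auto intro!: always_eventually Bochner_Integration.integral_nonneg\<close>)
  have "u \<in> W11 half_space" using u by (auto simp: W11_def)
  moreover have "trace_of (G (0, 1)) absolutely_integrable_on UNIV"
    by (rule lborel_integrable_imp_absolutely_integrable[OF tr]) simp
  ultimately show ?thesis
    unfolding has_trace_def using v(1) lim lim' by blast
qed

text \<open>Take the sequence that witnesses t as a trace: its boundary values converge in L^1 to t
  by definition, and to \<open>trace_of (G (0, 1))\<close> by the continuity estimate.\<close>

lemma has_trace_unique: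
  assumes t: "has_trace u t"
  shows "AE x in lborel. t x = trace_of (G (0, 1)) x"
proof -
  define s where "s = trace_of (G (0, 1))"
  obtain v where v: "\<And>k::nat. test_fun UNIV (v k)"
      "(\<lambda>k. W11_norm half_space (\<lambda>z. v k z - u z)) \<longlonglongrightarrow> 0"
      "(\<lambda>k. LINT x|lebesgue. \<bar>v k (x, 0) - t x\<bar>) \<longlonglongrightarrow> 0"
    using t unfolding has_trace_def by blast
  have It: "integrable lebesgue t"
    using t by (simp add: has_trace_def set_integrable_def)
  have s: "integrable lborel s"
    unfolding s_def by (rule trace_of_integrable(2)[OF vertical_integrable])
  then have Is: "integrable lebesgue s" using integrable_completion[of s lborel] by simp
  have I: "integrable lborel (\<lambda>x. v k (x, 0))" for k
    by (rule integral_trace_test_fun_diff(1)[OF v(1) vertical_integrable])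
  then have Iv: "integrable lebesgue (\<lambda>x. v k (x, 0))" for k
    using integrable_completion[of "\<lambda>x. v k (x, 0)" lborel] by simp
  have "(LINT x|lebesgue. \<bar>t x - s x\<bar>) \<le> (LINT x|lebesgue. \<bar>v k (x, 0) - t x\<bar>) + W11_norm half_space (\<lambda>z. v k z - u z)" for k
  proof -
    have "(LINT x|lebesgue. \<bar>t x - s x\<bar>) \<le> (LINT x|lebesgue. \<bar>v k (x, 0) - t x\<bar> + \<bar>v k (x, 0) - s x\<bar>)"
      using It Is Iv[of k] by (intro integral_mono) auto
    also have "\<dots> = (LINT x|lebesgue. \<bar>v k (x, 0) - t x\<bar>) + (LINT x|lebesgue. \<bar>v k (x, 0) - s x\<bar>)"
      using It Is Iv[of k] by (intro Bochner_Integration.integral_add) auto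
    also have "(LINT x|lebesgue. \<bar>v k (x, 0) - s x\<bar>) = (LINT x|lborel. \<bar>v k (x, 0) - s x\<bar>)"
      using s I[of k] by (intro integral_completion) auto
    also have "\<dots> \<le> W11_norm half_space (\<lambda>z. v k z - u z)"
      unfolding s_def by (rule integral_trace_diff_le_W11_norm[OF v(1)])
    finally show ?thesis by simp
  qed
  then have "(LINT x|lebesgue. \<bar>t x - s x\<bar>) \<le> 0 + 0"
    by (intro LIMSEQ_le_const[OF tendsto_add[OF v(3,2)]]) auto
  then have "(LINT x|lebesgue. \<bar>t x - s x\<bar>) = 0"
    by (intro antisym Bochner_Integration.integral_nonneg) auto
  then have "AE x in lebesgue. \<bar>t x - s x\<bar> = 0"
    using integral_nonneg_eq_0_iff_AE[of lebesgue "\<lambda>x. \<bar>t x - s x\<bar>"] It Is by simp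
  then show ?thesis by (simp add: AE_completion_iff s_def)
qed

text \<open>Replaces the chosen trace and gradient in \<open>J\<close> by explicit ones. Since m is
  the L^1 norm of the trace, vanishing of the trace almost everywhere becomes m = 0.\<close>

lemma J_eq:
  defines "m \<equiv> (LINT x|lborel. \<bar>trace_of (G (0, 1)) x\<bar>)"
  shows "J u = (if m = 0 then \<infinity> else ereal ((LINT z:half_space|lebesgue. norm (g z)) / m))"
proof -
  define s where "s = trace_of (G (0, 1))"
  have s: "integrable lborel s"
    unfolding s_def by (rule trace_of_integrable(2)[OF vertical_integrable])
  have "has_trace u (bd_trace u)"
    unfolding bd_trace_def by (rule someI[of "has_trace u", OF has_trace_trace_of])
  then have eq: "AE x in lebesgue. bd_trace u x = s x" and It: "integrable lebesgue (bd_trace u)"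
    using has_trace_unique[of "bd_trace u"]
    by (simp_all add: AE_completion_iff s_def has_trace_def set_integrable_def)
  have "(LINT x|lebesgue. \<bar>bd_trace u x\<bar>) = (LINT x|lebesgue. \<bar>s x\<bar>)"
    by (rule integral_cong_AE)
      (use It s in \<open>auto intro!: measurable_completion eventually_mono[OF eq]\<close>)
  also have "\<dots> = m"
    using s unfolding m_def s_def[symmetric] by (intro integral_completion) auto
  finally have m: "(LINT x|lebesgue. \<bar>bd_trace u x\<bar>) = m" .
  have "(AE x in lebesgue. bd_trace u x = 0) \<longleftrightarrow> m = 0"
    using integral_nonneg_eq_0_iff_AE[of lebesgue "\<lambda>x. \<bar>bd_trace u x\<bar>"] It m by simp
  then show ?thesis
    by (simp add: J_def m integral_norm_weak_grad[OF u])
qed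

lemma trace_le_norm_grad:
  "(LINT x|lborel. \<bar>trace_of (G (0, 1)) x\<bar>) \<le> (LINT z:half_space|lebesgue. norm (g z))"
proof -
  have "(LINT x|lborel. \<bar>trace_of (G (0, 1)) x\<bar>) \<le> (LINT z:half_space|lborel. \<bar>G (0, 1) z\<bar>)"
    by (rule trace_of_integrable(4)[OF vertical_integrable])
  also have "\<dots> \<le> (LINT z:half_space|lebesgue. norm (g z))"
    using u G by (intro integral_norm_le_sum(2) vertical_Basis) (auto simp: has_weak_grad_def)
  finally show ?thesis .
qed

end

lemma J_ge_1:
  fixes u :: "'a::euclidean_space \<times> real \<Rightarrow> real"
  assumes "u \<in> W11 half_space"
  shows "J u \<ge> 1"
proof -
  obtain g where u: "has_weak_grad half_space u g" using assms by (auto simp: W11_def)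
  have I: "u absolutely_integrable_on half_space" "g absolutely_integrable_on half_space"
    using u by (auto simp: has_weak_grad_def)
  obtain u' where u': "borel_rep u u'" using borel_representative[OF I(1)] .
  obtain G where G: "\<forall>i\<in>Basis. borel_rep (\<lambda>z. g z \<bullet> i) (G i)"
    using borel_representative_vector[OF I(2)] .
  define m where "m = (LINT x|lborel. \<bar>trace_of (G (0, 1)) x\<bar>)"
  have "m \<ge> 0" unfolding m_def by (intro Bochner_Integration.integral_nonneg) auto
  moreover have "m \<le> (LINT z:half_space|lebesgue. norm (g z))"
    using trace_le_norm_grad[OF u u' G] by (simp add: m_def)
  ultimately show ?thesis
    unfolding J_eq[OF u u' G] m_def[symmetric] by (auto simp: one_ereal_def)
qed

text \<open>The explicit form displays the sign: in the vertical direction the factor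
  \<open>z \<bullet> i\<close> is the height. It also displays the vanishing from the unit sphere
  outwards.\<close>

lemma pd_bump: "pd i bump z = - 2 * (z \<bullet> i) * flat_exp [:0, 0, 1:] (1 - z \<bullet> z)"
proof -
  have "((\<lambda>z::'a. 1 - z \<bullet> z) has_derivative (\<lambda>h. - (2 * (z \<bullet> h)))) (at z)"
    by (auto intro!: derivative_eq_intros simp: inner_commute)
  from DERIV_compose_FDERIV[OF flat_exp_deriv[of "[:1:]"] this]
  have "(bump has_derivative (\<lambda>h. - (2 * (z \<bullet> h)) * flat_exp ([:0, 0, 1:] * ([:1:] - pderiv [:1:])) (1 - z \<bullet> z))) (at z)"
    by (simp add: bump_def[abs_def])
  from pd_eq[OF this] show ?thesis by (simp add: pderiv_pCons)
qed

section \<open>Bumps squeezed towards the boundary\<close>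

definition squeeze :: "real \<Rightarrow> 'a::euclidean_space \<times> real \<Rightarrow> 'a \<times> real" where
  "squeeze c z = (fst z, c * snd z)"

lemma bounded_linear_squeeze: "bounded_linear (squeeze c)"
  unfolding squeeze_def[abs_def]
  by (intro bounded_linear_Pair bounded_linear_fst bounded_linear_const_mult bounded_linear_snd)

context
  fixes c :: real and v :: "'a::euclidean_space \<times> real \<Rightarrow> real"
  assumes c: "c \<ge> 1" and v_def: "v = (\<lambda>z. bump (squeeze c z))"
begin

lemma test_fun_squeezed_bump: "test_fun UNIV v"
proof (rule test_funI[of _ "cball 0 1"])
  show "smooth v"
    using smooth_affine[OF bounded_linear_squeeze smooth_bump, of 0 c] by (simp add: v_def)
  fix z :: "'a \<times> real" assume "z \<notin> cball 0 1"
  \<comment> \<open>Because c \<ge> 1, \<open>squeeze\<close> never decreases the norm, so the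
    support stays in the unit ball for every c.\<close>
  moreover have "(snd z)\<^sup>2 \<le> (c * snd z)\<^sup>2"
    using c mult_right_mono[of 1 "c\<^sup>2" "(snd z)\<^sup>2"] by (simp add: power_mult_distrib one_le_power)
  then have "norm z \<le> norm (squeeze c z)"
    by (simp add: squeeze_def norm_prod_def)
  ultimately show "v z = 0" by (auto simp: v_def intro: bump_eq_0)
qed auto

lemma pd_squeezed_bump: "pd i v z = pd (squeeze c i) bump (squeeze c z)"
proof -
  have D: "(bump has_derivative (\<lambda>h. pd h bump (squeeze c z))) (at (squeeze c z))"
    by (rule pd_has_derivative[OF smooth_differentiable[OF smooth_bump]])
  have "(v has_derivative (\<lambda>h. pd (squeeze c h) bump (squeeze c z))) (at z)"
    unfolding v_def
    by (rule has_derivative_compose[OF bounded_linear_imp_has_derivative[OF bounded_linear_squeeze] D])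
  then show ?thesis by (rule pd_eq)
qed

lemma squeezed_bump_boundary: "v (x, 0) = bump (x, 0 :: real)"
  by (simp add: v_def squeeze_def)

lemma integral_pd_vertical_squeezed_bump:
  "(LINT z:half_space|lborel. \<bar>pd (0, 1) v z\<bar>) = (LINT x|lborel. bump (x :: 'a, 0 :: real))"
proof -
  note T = test_fun_squeezed_bump
  \<comment> \<open>The direction (0, 1) becomes (0, c) and the height y becomes c y, so the
    explicit formula reads -2 c^2 y times a nonnegative factor.\<close>
  have "pd (0, 1) v z \<le> 0" if "z \<in> half_space" for z
    using that c by (auto simp: pd_squeezed_bump pd_bump squeeze_def half_space_def flat_exp_def inner_prod_def)
  then have "(LINT z:half_space|lborel. \<bar>pd (0, 1) v z\<bar>) = (LINT z:half_space|lborel. - pd (0, 1) v z)"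
    unfolding set_lebesgue_integral_def
    by (intro Bochner_Integration.integral_cong) (auto simp: indicator_def)
  also have "\<dots> = - (LINT z:half_space|lborel. pd (0, 1) v z)"
    by (simp add: set_lebesgue_integral_def)
  also have "\<dots> = (LINT x|lborel. trace_of (pd (0, 1) v) x)"
    using trace_of_integrable(3)[OF test_fun_integrable[OF test_fun_pd[OF T vertical_Basis]]] by simp
  also have "\<dots> = (LINT x|lborel. bump (x :: 'a, 0 :: real))"
    by (simp add: trace_of_test_fun[OF T] squeezed_bump_boundary)
  finally show ?thesis .
qed

text \<open>Bound the norm of the gradient by the sum of the absolute partials: the vertical one
  contributes exactly m, hence the summand 1, and the horizontal ones are the whole error.\<close>

lemma J_squeezed_bump_le:
  defines "m \<equiv> (LINT x|lborel. bump (x :: 'a, 0 :: real))"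
  shows "m > 0" and "J v \<le> ereal (1 + (\<Sum>i\<in>Basis - {(0, 1)}. LINT z:half_space|lborel. \<bar>pd i v z\<bar>) / m)"
proof -
  note T = test_fun_squeezed_bump
  note g = has_weak_grad_test_fun[OF T]
  have v': "borel_rep v v" using test_fun_integrable[OF T] by (simp add: borel_rep_def)
  have G: "\<forall>i\<in>Basis. borel_rep (\<lambda>z. grad v z \<bullet> i) (pd i v)"
    using test_fun_integrable[OF test_fun_pd[OF T]] by (simp add: borel_rep_def)
  have s: "trace_of (pd (0, 1) v) = (\<lambda>x. bump (x, 0 :: real))"
    by (intro ext) (simp add: trace_of_test_fun[OF T] squeezed_bump_boundary)
  have I: "integrable lborel (\<lambda>x::'a. bump (x, 0 :: real))"
    using trace_of_integrable(2)[OF test_fun_integrable[OF test_fun_pd[OF T vertical_Basis]]] by (simp add: s)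
  have "m \<noteq> 0"
  proof
    assume "m = 0"
    then have "AE x in lborel. bump (x::'a, 0::real) = 0"
      using integral_nonneg_eq_0_iff_AE[OF I] by (simp add: m_def bump_nonneg)
    then have "AE x in lborel. (x::'a) \<notin> ball 0 1"
    proof (rule eventually_mono)
      fix x :: 'a assume "bump (x, 0::real) = 0"
      then show "x \<notin> ball 0 1" using bump_pos[of "(x, 0::real)"] by auto
    qed
    then show False using AE_notin_open[of "ball (0::'a) 1"] by simp
  qed
  moreover have "m \<ge> 0" unfolding m_def by (intro Bochner_Integration.integral_nonneg) (auto simp: bump_nonneg)
  ultimately show m: "m > 0" by simp
  have "(LINT z:half_space|lebesgue. norm (grad v z)) \<le> (\<Sum>i\<in>Basis. LINT z:half_space|lborel. \<bar>pd i v z\<bar>)"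
    using g G by (intro integral_norm_le_sum(1)) (auto simp: has_weak_grad_def)
  also have "\<dots> = m + (\<Sum>i\<in>Basis - {(0, 1)}. LINT z:half_space|lborel. \<bar>pd i v z\<bar>)"
    by (subst sum.remove[OF finite_Basis vertical_Basis]) (simp add: integral_pd_vertical_squeezed_bump m_def)
  finally have "(LINT z:half_space|lebesgue. norm (grad v z)) / m \<le> 1 + (\<Sum>i\<in>Basis - {(0, 1)}. LINT z:half_space|lborel. \<bar>pd i v z\<bar>) / m"
    using m by (simp add: field_simps)
  moreover have "(LINT x|lborel. \<bar>trace_of (pd (0, 1) v) x\<bar>) = m"
    by (simp add: s m_def bump_nonneg)
  ultimately show "J v \<le> ereal (1 + (\<Sum>i\<in>Basis - {(0, 1)}. LINT z:half_space|lborel. \<bar>pd i v z\<bar>) / m)"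
    using J_eq[OF g v' G] m by simp
qed

lemma squeezed_bump_nonzero: "\<not> (AE z in lborel. z \<in> half_space \<longrightarrow> v z = 0)"
proof
  assume "AE z in lborel. z \<in> half_space \<longrightarrow> v z = 0"
  then have "AE z in lborel. z \<notin> half_space \<inter> {z. 0 < v z}"
    by (rule eventually_mono) auto
  moreover have "open (half_space \<inter> {z. 0 < v z})"
    using smooth_continuous[OF test_fun_smooth[OF test_fun_squeezed_bump], of UNIV]
    by (intro open_Int open_half_space open_Collect_less) auto
  ultimately have "half_space \<inter> {z. 0 < v z} = {}" by (rule AE_notin_open[rotated])
  \<comment> \<open>\<open>squeeze\<close> sends this point to height 1 / 2 on the axis, inside the
    unit ball where the bump is positive.\<close>
  moreover have "(0, 1 / (2 * c)) \<in> half_space \<inter> {z. 0 < v z}"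
    using c by (auto simp: half_space_def v_def squeeze_def norm_Pair intro!: bump_pos)
  ultimately show False by blast
qed

end

text \<open>For a fixed point of the half-space the squeezed point leaves the unit ball once n is
  large, so the integrand is eventually 0 there. All supports lie in the unit ball and one bound B
  serves every n, so dominated convergence applies.\<close>

lemma integral_pd_horizontal_tendsto_0:
  fixes i :: "'a::euclidean_space \<times> real"
  assumes i: "i \<in> Basis - {(0, 1)}"
  shows "(\<lambda>n. LINT z:half_space|lborel. \<bar>pd i (\<lambda>z. bump (squeeze (real (Suc n)) z)) z\<bar>) \<longlonglongrightarrow> 0"
proof -
  define v where "v n = (\<lambda>z::'a \<times> real. bump (squeeze (real (Suc n)) z))" for n
  have T: "test_fun UNIV (v n)" for n
    by (rule test_fun_squeezed_bump[of "real (Suc n)"]) (auto simp: v_def)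
  \<comment> \<open>Horizontal basis vectors are fixed by \<open>squeeze\<close>, so the chain rule
    brings out no factor c that could offset the shrinking supports.\<close>
  have sq: "squeeze c i = i" for c
    using i by (auto simp: Basis_prod_def squeeze_def)
  have pd: "pd i (v n) z = pd i bump (squeeze (real (Suc n)) z)" for n z
    by (subst pd_squeezed_bump[of "real (Suc n)"]) (auto simp: v_def sq)
  obtain B where B: "B > 0" "\<And>z. \<bar>pd i bump z\<bar> \<le> B"
    using test_fun_bounded[OF test_fun_pd[OF test_fun_bump]] i by (metis DiffD1)
  have out: "pd i bump z = 0" if "norm z \<ge> 1" for z :: "'a \<times> real"
    using that one_le_power[of "norm z" 2] by (auto simp: pd_bump flat_exp_def power2_norm_eq_inner[symmetric] simp del: one_le_power)
  have "(\<lambda>n. LINT z|lborel. indicator half_space z *\<^sub>R \<bar>pd i (v n) z\<bar>) \<longlonglongrightarrow> (LINT z|(lborel :: ('a \<times> real) measure). 0)"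
  proof (rule integral_dominated_convergence[where w="\<lambda>z. B * indicator (cball 0 1) z"])
    show "integrable lborel (\<lambda>z::'a \<times> real. B * indicator (cball 0 1) z)"
      using emeasure_compact_finite[of "cball (0::'a \<times> real) 1"]
      by (auto intro!: integrable_mult_right integrable_real_indicator)
    have m: "pd i (v n) \<in> borel_measurable borel" for n
      using i by (intro smooth_measurable smooth_pd test_fun_smooth[OF T]) auto
    show "(\<lambda>z. indicator half_space z *\<^sub>R \<bar>pd i (v n) z\<bar>) \<in> borel_measurable lborel" for n
      using m[of n] by auto
    show "AE z in lborel. (\<lambda>n. indicator half_space z *\<^sub>R \<bar>pd i (v n) z\<bar>) \<longlonglongrightarrow> 0"
    proof (intro AE_I2 tendsto_eventually)
      fix z :: "'a \<times> real"
      show "\<forall>\<^sub>F n in sequentially. indicator half_space z *\<^sub>R \<bar>pd i (v n) z\<bar> = 0"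
      proof (cases "z \<in> half_space")
        case True
        then have z: "snd z > 0" by (auto simp: half_space_def)
        obtain k :: nat where k: "1 / snd z < real k" using reals_Archimedean2 by blast
        have "pd i (v n) z = 0" if "n \<ge> k" for n
        proof -
          have "1 < real k * snd z" using k z by (simp add: field_simps)
          also have "\<dots> \<le> real (Suc n) * snd z" using z that by (intro mult_right_mono) auto
          also have "\<dots> \<le> norm (squeeze (real (Suc n)) z)"
            using norm_snd_le[of "real (Suc n) * snd z" "fst z"] by (simp add: squeeze_def)
          finally show ?thesis unfolding pd by (intro out) simp
        qed
        then show ?thesis by (auto simp: eventually_sequentially)
      qed simp
    qed
    show "AE z in lborel. norm (indicator half_space z *\<^sub>R \<bar>pd i (v n) z\<bar>) \<le> B * indicator (cball 0 1) z" for n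
    proof (rule AE_I2)
      fix z :: "'a \<times> real"
      show "norm (indicator half_space z *\<^sub>R \<bar>pd i (v n) z\<bar>) \<le> B * indicator (cball 0 1) z"
      proof (cases "z \<in> cball 0 1")
        case True
        then show ?thesis using B(1) B(2)[of "squeeze (real (Suc n)) z"] by (simp add: pd indicator_def)
      next
        case False
        have "v n z = 0" if "z \<notin> cball 0 1" for z
        proof -
          have "(snd z)\<^sup>2 \<le> (real (Suc n) * snd z)\<^sup>2"
            using mult_right_mono[of 1 "(real (Suc n))\<^sup>2" "(snd z)\<^sup>2"] one_le_power[of "real (Suc n)" 2]
            by (simp add: power_mult_distrib)
          then have "norm z \<le> norm (squeeze (real (Suc n)) z)"
            by (simp add: squeeze_def norm_prod_def)
          then show ?thesis using that by (auto simp: v_def intro: bump_eq_0)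
        qed
        then have "pd i (v n) z = 0" using False by (intro pd_eq_0_outside[OF closed_cball[of 0 1]]) auto
        then show ?thesis using B(1) by simp
      qed
    qed
  qed auto
  then show ?thesis by (simp add: set_lebesgue_integral_def v_def)
qed

theorem theorem10:
  shows "Inf {J u | u :: (real ^ 'n) \<times> real \<Rightarrow> real.
           u \<in> W11 half_space \<and> \<not> (AE z in lebesgue. z \<in> half_space \<longrightarrow> u z = 0)} = 1"
    (is "Inf ?S = 1")
proof (rule antisym)
  show "1 \<le> Inf ?S" by (rule Inf_greatest) (auto intro: J_ge_1)
  define v where "v n = (\<lambda>z::(real ^ 'n) \<times> real. bump (squeeze (real (Suc n)) z))" for n
  define m where "m = (LINT x|lborel. bump (x :: real ^ 'n, 0 :: real))"
  have c: "real (Suc n) \<ge> 1" for n by simp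
  have "v n \<in> W11 half_space" for n
    using has_weak_grad_test_fun[OF test_fun_squeezed_bump[OF c v_def]] by (auto simp: W11_def)
  then have mem: "J (v n) \<in> ?S" for n
    using squeezed_bump_nonzero[OF c v_def[of n]] by (auto simp: AE_completion_iff)
  have le: "Inf ?S \<le> ereal (1 + (\<Sum>i\<in>Basis - {(0, 1)}. LINT z:half_space|lborel. \<bar>pd i (v n) z\<bar>) / m)" for n
    using Inf_lower[OF mem[of n]] J_squeezed_bump_le(2)[OF c v_def[of n]] unfolding m_def by (rule order_trans)
  \<comment> \<open>Finitely many horizontal terms tend to 0, while m is positive and the same for
    every n because squeezing preserves the boundary values.\<close>
  have "(\<lambda>n. 1 + (\<Sum>i\<in>Basis - {(0, 1)}. LINT z:half_space|lborel. \<bar>pd i (v n) z\<bar>) / m)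
      \<longlonglongrightarrow> 1 + (\<Sum>i\<in>(Basis :: ((real ^ 'n) \<times> real) set) - {(0, 1)}. 0) / m"
    using J_squeezed_bump_le(1)[OF c v_def[of 0]] unfolding v_def m_def
    by (intro tendsto_intros integral_pd_horizontal_tendsto_0) auto
  then have "(\<lambda>n. ereal (1 + (\<Sum>i\<in>Basis - {(0, 1)}. LINT z:half_space|lborel. \<bar>pd i (v n) z\<bar>) / m)) \<longlonglongrightarrow> 1"
    by (simp add: one_ereal_def)
  from LIMSEQ_le_const[OF this] show "Inf ?S \<le> 1" using le by blast
qed

end
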